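(* Let $\lambda,\mu,\nu$ be partitions with $\mu_i\le\lambda_i$ for all $i$, such that the skew diagram $\lambda/\mu$ is connected. Then, in the algebra $\Lambda$ of symmetric functions in infinitely many variables $x_1,x_2,\dots$, $$s_{\lambda/\mu}=s_\nu \quad\text{if and only if}\quad \lambda/\mu=\nu \ \text{ or } \ \lambda/\mu=\nu^\circ,$$ where equality of diagrams means equality of the arrays of boxes up to translation.
   Context: For a partition $\lambda=\lambda_1\ge\dots\ge\lambda_k>0$, the (Ferrers) diagram of $\lambda$ is the left-justified array of boxes with $\lambda_i$ boxes in row $i$ (rows numbered top to bottom). For partitions $\mu\subseteq\lambda$ (i.e. $\mu_i\le\lambda_i$ for all $i$), the skew diagram $\lambda/\mu$ is the set of boxes of the diagram of $\lambda$ not in the diagram of $\mu$. It is connected if any two adjacent nonempty rows share at least one column in which both have a box. A semi-standard skew tableau of shape $\lambda/\mu$ is a filling of its boxes with positive integers weakly increasing along rows and strictly increasing down columns; the skew Schur function is $s_{\lambda/\mu}=\sum_T x^T$ over all such $T$, where $x^T=\prod_i x_i^{t_i}$ and $t_i$ is the number of entries equal to $i$ in $T$; $s_\nu=s_{\nu/\emptyset}$. For a diagram $\nu$, $\nu^\circ$ denotes the skew diagram obtained by rotating the diagram of $\nu$ by $180^\circ$. *)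

theory Defs
  imports Main
begin

definition is_partition :: "nat list \<Rightarrow> bool" where
  "is_partition la \<longleftrightarrow> sorted_wrt (\<ge>) la \<and> 0 \<notin> set la"

definition part :: "nat list \<Rightarrow> nat \<Rightarrow> nat" where
  "part la i = (if i < length la then la ! i else 0)"

text \<open>Ferrers diagram: boxes (row, column), rows top to bottom, indexed from 0.\<close>
definition diagram :: "nat list \<Rightarrow> (nat \<times> nat) set" where
  "diagram la = {(i, j). i < length la \<and> j < la ! i}"

definition skew_diagram :: "nat list \<Rightarrow> nat list \<Rightarrow> (nat \<times> nat) set" where
  "skew_diagram la mu = diagram la - diagram mu"

definition row :: "(nat \<times> nat) set \<Rightarrow> nat \<Rightarrow> nat set" where
  "row D i = {j. (i, j) \<in> D}"

definition skew_connected :: "nat list \<Rightarrow> nat list \<Rightarrow> bool" where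
  "skew_connected la mu \<longleftrightarrow>
     (let D = skew_diagram la mu in
       (\<forall>i k. i \<le> k \<longrightarrow> row D i \<noteq> {} \<longrightarrow> row D k \<noteq> {} \<longrightarrow>
          (\<forall>m. i \<le> m \<and> m \<le> k \<longrightarrow> row D m \<noteq> {})) \<and>
       (\<forall>i. row D i \<noteq> {} \<longrightarrow> row D (Suc i) \<noteq> {} \<longrightarrow> row D i \<inter> row D (Suc i) \<noteq> {}))"

definition ssyt :: "(nat \<times> nat) set \<Rightarrow> (nat \<times> nat \<Rightarrow> nat) \<Rightarrow> bool" where
  "ssyt D T \<longleftrightarrow>
     (\<forall>c. c \<notin> D \<longrightarrow> T c = 0) \<and> (\<forall>c\<in>D. T c \<ge> 1) \<and>
     (\<forall>i j j'. (i, j) \<in> D \<longrightarrow> (i, j') \<in> D \<longrightarrow> j < j' \<longrightarrow> T (i, j) \<le> T (i, j')) \<and>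
     (\<forall>i i' j. (i, j) \<in> D \<longrightarrow> (i', j) \<in> D \<longrightarrow> i < i' \<longrightarrow> T (i, j) < T (i', j))"

text \<open>Content t of a tableau: t k = number of entries equal to k (so x^T = prod x_k^(t k)).\<close>
definition content :: "(nat \<times> nat) set \<Rightarrow> (nat \<times> nat \<Rightarrow> nat) \<Rightarrow> nat \<Rightarrow> nat" where
  "content D T k = card {c \<in> D. T c = k}"

definition schur_coeff :: "(nat \<times> nat) set \<Rightarrow> (nat \<Rightarrow> nat) \<Rightarrow> nat" where
  "schur_coeff D alpha = card {T. ssyt D T \<and> content D T = alpha}"

text \<open>Equality of the generating functions (formal power series in x_1, x_2, ...):
  all monomial coefficients agree.\<close>
definition schur_eq :: "(nat \<times> nat) set \<Rightarrow> (nat \<times> nat) set \<Rightarrow> bool" where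
  "schur_eq D E \<longleftrightarrow> (\<forall>alpha. finite {k. alpha k \<noteq> 0} \<longrightarrow> schur_coeff D alpha = schur_coeff E alpha)"

definition to_int :: "(nat \<times> nat) set \<Rightarrow> (int \<times> int) set" where
  "to_int D = (\<lambda>(i, j). (int i, int j)) ` D"

definition same_up_to_translation :: "(int \<times> int) set \<Rightarrow> (int \<times> int) set \<Rightarrow> bool" where
  "same_up_to_translation A B \<longleftrightarrow> (\<exists>a b. (\<lambda>(i, j). (i + a, j + b)) ` A = B)"

text \<open>Rotation by 180 degrees (about the origin; position irrelevant up to translation).\<close>
definition rot180 :: "(int \<times> int) set \<Rightarrow> (int \<times> int) set" where
  "rot180 A = (\<lambda>(i, j). (- i, - j)) ` A"

end

theory Submission
  imports Defs
begin

text \<open>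
  A skew Schur function determines the lengths of the columns: filling every column with
  \<open>1, 2, 3, \<dots>\<close> gives the dominance-largest content. The identity
  \<open>\<Sum>\<^sub>i (-1)\<^sup>i e\<^sub>i h\<^sub>m\<^sub>-\<^sub>i = 0\<close>, valid for peeling off strips from a skew shape, lets one express the
  number of row-strict fillings by numbers of column-strict ones, so the Schur function also
  determines the lengths of the rows. With \<open>c\<^sub>j\<close> the column lengths and \<open>R\<^sub>i\<close> the rows,
  \<open>\<Sum>\<^sub>j c\<^sub>j\<^sup>2 = \<Sum>\<^sub>i\<^sub>,\<^sub>k |R\<^sub>i \<inter> R\<^sub>k| \<le> \<Sum>\<^sub>i\<^sub>,\<^sub>k min |R\<^sub>i| |R\<^sub>k|\<close>, with equality if and only if the
  rows form a chain. Equality holds for the diagram of a partition, hence for every skew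
  shape with the same Schur function. The first and the last row of such a shape are comparable,
  so they share their left or their right end, and by monotonicity all rows do; the shape is thus
  a partition or a rotated partition. Conversely, a rotated shape has the same tableaux with
  reversed content, and the Bender-Knuth involution shows that Schur functions are symmetric.
\<close>

subsection \<open>Peeling off strips\<close>

definition cell_le :: "nat \<times> nat \<Rightarrow> nat \<times> nat \<Rightarrow> bool" where
  "cell_le x y \<longleftrightarrow> fst x \<le> fst y \<and> snd x \<le> snd y"

text \<open>Convexity in the product order replaces pairs of partitions: skew diagrams have it and
  the removal of an initial strip preserves it, so inductions can run over finite convex
  sets.\<close>

definition cell_convex :: "(nat \<times> nat) set \<Rightarrow> bool" where
  "cell_convex D \<longleftrightarrow> (\<forall>x\<in>D. \<forall>z\<in>D. \<forall>y. cell_le x y \<longrightarrow> cell_le y z \<longrightarrow> y \<in> D)"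

text \<open>\<open>True\<close> selects columns and \<open>False\<close> rows: a strip of type \<open>True\<close> has at most one cell per
  column (a horizontal strip), one of type \<open>False\<close> at most one cell per row (a vertical strip).\<close>
definition line_of :: "bool \<Rightarrow> nat \<times> nat \<Rightarrow> nat" where
  "line_of t = (if t then snd else fst)"

text \<open>The order \<open>r\<close> is a parameter so that its converse describes strips taken
  off from the opposite end.\<close>

definition strips ::
  "(nat \<times> nat \<Rightarrow> nat \<times> nat \<Rightarrow> bool) \<Rightarrow> (nat \<times> nat) set \<Rightarrow> bool \<Rightarrow> nat \<Rightarrow> (nat \<times> nat) set set" where
  "strips r D t n = {A. A \<subseteq> D \<and> card A = n \<and> inj_on (line_of t) A \<and>
     (\<forall>x\<in>A. \<forall>y\<in>D. r y x \<longrightarrow> y \<in> A)}"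

text \<open>Counts the ways to peel all of \<open>D\<close> off in \<open>r\<close>-initial strips of the given types and sizes. For
  words over \<open>True\<close> and the componentwise order these are the semistandard tableaux with the
  given content.\<close>
fun peelings ::
  "(nat \<times> nat \<Rightarrow> nat \<times> nat \<Rightarrow> bool) \<Rightarrow> (nat \<times> nat) set \<Rightarrow> (bool \<times> nat) list \<Rightarrow> int" where
  "peelings r D [] = (if D = {} then 1 else 0)"
| "peelings r D ((t, n) # w) = (\<Sum>A\<in>strips r D t n. peelings r (D - A) w)"

lemma cell_le_simps [simp]: "cell_le (i, j) (i', j') \<longleftrightarrow> i \<le> i' \<and> j \<le> j'"
  by (simp add: cell_le_def)

lemma cell_le_refl [simp]: "cell_le x x"
  by (simp add: cell_le_def)

lemma cell_convexD:
  "cell_convex D \<Longrightarrow> x \<in> D \<Longrightarrow> z \<in> D \<Longrightarrow> cell_le x y \<Longrightarrow> cell_le y z \<Longrightarrow> y \<in> D"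
  unfolding cell_convex_def by blast

lemma stripsD:
  assumes "A \<in> strips r D t n"
  shows "A \<subseteq> D" "card A = n" "inj_on (line_of t) A"
    "\<And>x y. x \<in> A \<Longrightarrow> y \<in> D \<Longrightarrow> r y x \<Longrightarrow> y \<in> A"
  using assms unfolding strips_def by auto

lemma stripsI:
  assumes "A \<subseteq> D" "card A = n"
    and "\<And>x y. x \<in> A \<Longrightarrow> y \<in> A \<Longrightarrow> line_of t x = line_of t y \<Longrightarrow> x = y"
    and "\<And>x y. x \<in> A \<Longrightarrow> y \<in> D \<Longrightarrow> r y x \<Longrightarrow> y \<in> A"
  shows "A \<in> strips r D t n"
  using assms unfolding strips_def inj_on_def by auto

lemma finite_strips: "finite D \<Longrightarrow> finite (strips r D t n)"
  by (rule finite_subset[of _ "Pow D"]) (auto simp: strips_def)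

lemma cell_convex_diff:
  assumes "cell_convex D" "A \<in> strips cell_le D t n"
  shows "cell_convex (D - A)"
  unfolding cell_convex_def
proof (intro ballI allI impI)
  fix x z y assume *: "x \<in> D - A" "z \<in> D - A" "cell_le x y" "cell_le y z"
  then have "y \<in> D" using cell_convexD[OF assms(1)] by blast
  moreover have "y \<notin> A" using stripsD(4)[OF assms(2), of y x] * by auto
  ultimately show "y \<in> D - A" by simp
qed

lemma strips_zero: "finite D \<Longrightarrow> strips r D t 0 = {{}}"
  by (auto simp: strips_def dest: finite_subset)

lemma peelings_nonneg: "0 \<le> peelings r D w"
  by (induction r D w rule: peelings.induct) (auto intro: sum_nonneg)

lemma peelings_drop_zero:
  "finite D \<Longrightarrow> peelings r D (u @ (t, 0) # w) = peelings r D (u @ w)"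
proof (induction u arbitrary: D)
  case Nil
  then show ?case by (simp add: strips_zero)
next
  case (Cons p u)
  then show ?case by (cases p) auto
qed

section \<open>Moving a corner between two strips\<close>

lemma corner_exists:
  fixes S :: "(nat \<times> nat) set"
  assumes "finite S" "S \<noteq> {}"
  shows "\<exists>c\<in>S. \<forall>x\<in>S. fst x < fst c \<or> fst x = fst c \<and> snd c \<le> snd x"
proof -
  let ?i = "Max (fst ` S)"
  let ?J = "{j. (?i, j) \<in> S}"
  have "?i \<in> fst ` S" using assms by simp
  then have ne: "?J \<noteq> {}" by (auto simp: image_iff)
  have "?J \<subseteq> snd ` S" by force
  then have fin: "finite ?J" using assms finite_subset by blast
  have c: "(?i, Min ?J) \<in> S" using Min_in[OF fin ne] by simp
  have "fst x < ?i \<or> fst x = ?i \<and> Min ?J \<le> snd x" if "x \<in> S" for x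
  proof (cases "fst x = ?i")
    case True
    then have "snd x \<in> ?J" using that by (metis (mono_tags, lifting) mem_Collect_eq prod.collapse)
    then show ?thesis using True fin by simp
  next
    case False
    moreover have "fst x \<le> ?i" using that assms by simp
    ultimately show ?thesis by simp
  qed
  then show ?thesis using c by (intro bexI[of _ "(?i, Min ?J)"]) auto
qed

text \<open>The choice depends on the set alone. Applied to the union of two strips, it returns the
  same cell after that cell has changed strips, so the move undoes itself.\<close>

definition corner :: "(nat \<times> nat) set \<Rightarrow> nat \<times> nat" where
  "corner S = (SOME c. c \<in> S \<and> (\<forall>x\<in>S. fst x < fst c \<or> fst x = fst c \<and> snd c \<le> snd x))"

lemma corner:
  assumes "finite S" "S \<noteq> {}"
  shows "corner S \<in> S"
    "x \<in> S \<Longrightarrow> fst x < fst (corner S) \<or> fst x = fst (corner S) \<and> snd (corner S) \<le> snd x"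
  using someI_ex[of "\<lambda>c. c \<in> S \<and> (\<forall>x\<in>S. fst x < fst c \<or> fst x = fst c \<and> snd c \<le> snd x)"]
    corner_exists[OF assms] unfolding corner_def[symmetric] by blast+

text \<open>Since \<open>c\<close> lies in the lowest row of the union, a cell of \<open>B\<close>
  in its column would lie above it and so belong to the initial set \<open>A\<close>. A cell of
  \<open>A\<close> beyond \<open>c\<close> would lie in the row of \<open>c\<close>, where
  \<open>A\<close> has no second cell.\<close>

lemma corner_to_horizontal:
  assumes D: "finite D" and A: "A \<in> strips cell_le D False m" and B: "B \<in> strips cell_le (D - A) True k"
    and c: "c \<in> A"
    and cor: "\<And>x. x \<in> A \<union> B \<Longrightarrow> fst x < fst c \<or> fst x = fst c \<and> snd c \<le> snd x"
  shows "A - {c} \<in> strips cell_le D False (m - 1)"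
    and "insert c B \<in> strips cell_le (D - (A - {c})) True (Suc k)"
proof -
  note a = stripsD[OF A] and b = stripsD[OF B]
  have fin: "finite A" "finite B" using D a(1) b(1) by (auto dest: finite_subset)
  have rowA: "x = y" if "x \<in> A" "y \<in> A" "fst x = fst y" for x y
    using a(3) that by (auto simp: line_of_def inj_on_def)
  have colB: "x = y" if "x \<in> B" "y \<in> B" "snd x = snd y" for x y
    using b(3) that by (auto simp: line_of_def inj_on_def)
  have colc: "snd x \<noteq> snd c" if "x \<in> B" for x
  proof
    assume "snd x = snd c"
    then have "cell_le x c" using cor[of x] that by (auto simp: cell_le_def)
    then have "x \<in> A" using a(4)[OF c] b(1) that by blast
    then show False using b(1) that by blast
  qed
  show "A - {c} \<in> strips cell_le D False (m - 1)"
  proof (rule stripsI)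
    fix x y assume *: "x \<in> A - {c}" "y \<in> D" "cell_le y x"
    have "y \<in> A" using a(4) * by blast
    moreover have "y \<noteq> c"
    proof
      assume "y = c"
      then have "fst x = fst c" using * cor[of x] by (auto simp: cell_le_def)
      then show False using rowA[of x c] * c by auto
    qed
    ultimately show "y \<in> A - {c}" by simp
  qed (use a fin c rowA in \<open>auto simp: line_of_def\<close>)
  show "insert c B \<in> strips cell_le (D - (A - {c})) True (Suc k)"
  proof (rule stripsI)
    show "insert c B \<subseteq> D - (A - {c})" using a(1) b(1) c by blast
    show "card (insert c B) = Suc k" using fin b(1,2) c by (subst card_insert_disjoint) auto
    show "x = y" if "x \<in> insert c B" "y \<in> insert c B" "line_of True x = line_of True y" for x y
      using that colB colc by (auto simp: line_of_def) (metis prod.collapse snd_conv)+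
    show "y \<in> insert c B" if "x \<in> insert c B" "y \<in> D - (A - {c})" "cell_le y x" for x y
      using that a(4)[OF c, of y] b(4)[of x y] by blast
  qed
qed

text \<open>A cell of \<open>A\<close> in the row of \<open>c\<close> would lie to its right and
  pull \<open>c\<close> into \<open>A\<close>. All cells of \<open>D\<close> strictly before
  \<open>c\<close> are in \<open>A\<close>, so \<open>A\<close> stays initial when \<open>c\<close>
  joins it.\<close>

lemma corner_to_vertical:
  assumes D: "finite D" and conv: "cell_convex D"
    and A: "A \<in> strips cell_le D False m" and B: "B \<in> strips cell_le (D - A) True k"
    and c: "c \<in> B"
    and cor: "\<And>x. x \<in> A \<union> B \<Longrightarrow> fst x < fst c \<or> fst x = fst c \<and> snd c \<le> snd x"
  shows "insert c A \<in> strips cell_le D False (Suc m)"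
    and "B - {c} \<in> strips cell_le (D - insert c A) True (k - 1)"
proof -
  note a = stripsD[OF A] and b = stripsD[OF B]
  have fin: "finite A" "finite B" using D a(1) b(1) by (auto dest: finite_subset)
  have rowA: "x = y" if "x \<in> A" "y \<in> A" "fst x = fst y" for x y
    using a(3) that by (auto simp: line_of_def inj_on_def)
  have colB: "x = y" if "x \<in> B" "y \<in> B" "snd x = snd y" for x y
    using b(3) that by (auto simp: line_of_def inj_on_def)
  have cD: "c \<in> D" "c \<notin> A" using c b(1) by auto
  have rowc: "fst x \<noteq> fst c" if "x \<in> A" for x
  proof
    assume "fst x = fst c"
    then have "cell_le c x" using cor[of x] that by (auto simp: cell_le_def)
    then show False using a(4)[OF that cD(1)] cD(2) by simp
  qed
  have below: "y \<in> A" if "y \<in> D" "cell_le y c" "y \<noteq> c" for y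
  proof (rule ccontr)
    assume "y \<notin> A"
    then have yB: "y \<in> B" using b(4)[OF c] that by blast
    have y: "fst y \<le> fst c" "snd y \<le> snd c" using that by (auto simp: cell_le_def)
    have "snd y \<noteq> snd c" using colB[OF yB c] that by blast
    \<comment> \<open>Convexity puts this cell into \<open>D\<close> and closure puts it into the
      union, yet it would lie to the left of the corner in the corner's own row.\<close>
    let ?z = "(fst c, snd y)"
    have zD: "?z \<in> D"
      using y by (intro cell_convexD[OF conv that(1) cD(1)]) (auto simp: cell_le_def)
    have "cell_le ?z c" using y by (simp add: cell_le_def)
    then have "?z \<in> A \<union> B" using zD b(4)[OF c] by blast
    from cor[OF this] show False using y \<open>snd y \<noteq> snd c\<close> by simp
  qed
  show "insert c A \<in> strips cell_le D False (Suc m)"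
  proof (rule stripsI)
    show "insert c A \<subseteq> D" using a(1) cD by blast
    show "card (insert c A) = Suc m" using fin a(2) cD by simp
    show "x = y" if "x \<in> insert c A" "y \<in> insert c A" "line_of False x = line_of False y" for x y
      using that rowA rowc by (auto simp: line_of_def) (metis prod.collapse fst_conv)+
    show "y \<in> insert c A" if "x \<in> insert c A" "y \<in> D" "cell_le y x" for x y
      using that a(4)[of x y] below[of y] by blast
  qed
  show "B - {c} \<in> strips cell_le (D - insert c A) True (k - 1)"
    using b c fin colB by (intro stripsI) (auto simp: line_of_def)
qed

text \<open>The identity \<open>\<Sum>\<^sub>i (-1)\<^sup>i e\<^sub>i h\<^sub>m\<^sub>-\<^sub>i = 0\<close>, proved by moving the lower left corner of
  the union of the two strips from one strip to the other.\<close>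
lemma peelings_alternating_sum_Nil:
  assumes D: "finite D" and conv: "cell_convex D" and m: "0 < m"
  shows "(\<Sum>i\<le>m. (-1) ^ i * peelings cell_le D ((False, i) # (True, m - i) # w)) = 0"
proof -
  define P where "P = (SIGMA i:{..m}. SIGMA A:strips cell_le D False i. strips cell_le (D - A) True (m - i))"
  define f where "f = (\<lambda>(i::nat, A, B). (-1) ^ i * peelings cell_le (D - A - B) w)"
  define g where "g = (\<lambda>(i::nat, A, B). let c = corner (A \<union> B) in
      if c \<in> A then (i - 1, A - {c}, insert c B) else (Suc i, insert c A, B - {c}))"
  have S: "(\<Sum>i\<le>m. (-1) ^ i * peelings cell_le D ((False, i) # (True, m - i) # w)) = sum f P"
    unfolding P_def f_def using D
    by (simp add: sum.Sigma[symmetric] finite_strips sum_distrib_left)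
  \<comment> \<open>\<open>g\<close> is a sign-reversing involution: it changes \<open>i\<close> by
    one and keeps the union of the strips, hence also the corner and the cells that remain to be
    peeled.\<close>
  have key: "g p \<in> P \<and> g (g p) = p \<and> f (g p) = - f p" if p: "p \<in> P" for p
  proof -
    obtain i A B where pe: "p = (i, A, B)" by (cases p)
    have i: "i \<le> m" and A: "A \<in> strips cell_le D False i" and B: "B \<in> strips cell_le (D - A) True (m - i)"
      using p unfolding P_def pe by auto
    have sub: "A \<subseteq> D" "B \<subseteq> D - A" using stripsD(1) A B by blast+
    have fin: "finite A" "finite B" using D sub by (auto dest: finite_subset)
    have ne: "A \<union> B \<noteq> {}"
      using stripsD(2)[OF A] stripsD(2)[OF B] m i by (cases "i = 0") auto
    define c where "c = corner (A \<union> B)"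
    have cin: "c \<in> A \<union> B" and cor: "\<And>x. x \<in> A \<union> B \<Longrightarrow> fst x < fst c \<or> fst x = fst c \<and> snd c \<le> snd x"
      using corner[of "A \<union> B"] ne fin unfolding c_def by auto
    show ?thesis
    proof (cases "c \<in> A")
      case True
      then have i0: "0 < i" using stripsD(2)[OF A] fin card_gt_0_iff by blast
      have g: "g p = (i - 1, A - {c}, insert c B)"
        using True unfolding g_def pe c_def by (simp add: Let_def)
      have u: "(A - {c}) \<union> insert c B = A \<union> B" using True by blast
      have "g p \<in> P"
        using corner_to_horizontal[OF D A B True cor] i i0 unfolding g P_def
        by (auto simp: Suc_diff_le)
      moreover have "g (g p) = p"
        unfolding g using True sub i0 unfolding g_def pe prod.case Let_def u c_def[symmetric]
        by auto
      moreover have "D - (A - {c}) - insert c B = D - A - B" using True by blast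
      ultimately show ?thesis using i0 unfolding g unfolding f_def pe
        by (cases i) auto
    next
      case False
      then have cB: "c \<in> B" using cin by blast
      then have i0: "i < m" using stripsD(2)[OF B] fin card_gt_0_iff i
        by (metis empty_iff zero_less_diff)
      have g: "g p = (Suc i, insert c A, B - {c})"
        using False unfolding g_def pe c_def by (simp add: Let_def)
      have u: "insert c A \<union> (B - {c}) = A \<union> B" using cB by blast
      have "g p \<in> P"
        using corner_to_vertical[OF D conv A B cB cor] i i0 unfolding g P_def
        by auto
      moreover have "g (g p) = p"
        unfolding g using False cB sub unfolding g_def pe prod.case Let_def u c_def[symmetric]
        by auto
      moreover have "D - insert c A - (B - {c}) = D - A - B" using cB by blast
      ultimately show ?thesis unfolding g unfolding f_def pe by auto
    qed
  qed
  have "sum f P = sum (\<lambda>p. - f p) P"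
    by (rule sum.reindex_bij_witness[of _ g g]) (use key in auto)
  then show ?thesis unfolding S by (simp add: sum_negf)
qed

text \<open>Peeling the strips of \<open>u\<close> first leaves a convex set, to which the case of
  the empty prefix applies.\<close>

lemma peelings_alternating_sum:
  assumes "finite D" "cell_convex D" "0 < m"
  shows "(\<Sum>i\<le>m. (-1) ^ i * peelings cell_le D (u @ (False, i) # (True, m - i) # w)) = 0"
  using assms
proof (induction u arbitrary: D)
  case Nil
  then show ?case using peelings_alternating_sum_Nil by simp
next
  case (Cons p u)
  obtain t n where p: "p = (t, n)" by (cases p)
  let ?h = "\<lambda>A i. (-1) ^ i * peelings cell_le (D - A) (u @ (False, i) # (True, m - i) # w)"
  have "(\<Sum>i\<le>m. (-1) ^ i * peelings cell_le D ((p # u) @ (False, i) # (True, m - i) # w))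
      = (\<Sum>i\<le>m. \<Sum>A\<in>strips cell_le D t n. ?h A i)"
    by (simp add: p sum_distrib_left)
  also have "\<dots> = (\<Sum>A\<in>strips cell_le D t n. \<Sum>i\<le>m. ?h A i)"
    by (rule sum.swap)
  also have "\<dots> = 0"
    using Cons cell_convex_diff by (intro sum.neutral ballI Cons.IH) auto
  finally show ?case .
qed

text \<open>A vertical strip of size \<open>m\<close> is rewritten by the alternating sum into words with fewer
  cells in vertical strips; this replaces the involution \<open>\<omega>\<close> on symmetric functions.\<close>
lemma peelings_determined_by_horizontal:
  assumes D: "finite D" "cell_convex D" and E: "finite E" "cell_convex E"
    and eq: "\<And>ns. peelings cell_le D (map (Pair True) ns) = peelings cell_le E (map (Pair True) ns)"
  shows "peelings cell_le D w = peelings cell_le E w"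
\<comment> \<open>A vertical strip of size \<open>n\<close> weighs \<open>Suc n\<close> rather than
  \<open>n\<close>, so that deleting an empty one also lowers the measure.\<close>
proof (induction "\<Sum>(t, n)\<leftarrow>w. if t then 0 else Suc n" arbitrary: w rule: less_induct)
  case less
  show ?case
  proof (cases "\<forall>p\<in>set w. fst p")
    case True
    then have "w = map (Pair True) (map snd w)" by (induction w) auto
    then show ?thesis using eq by metis
  next
    case False
    then obtain u m v where w: "w = u @ (False, m) # v"
      by (metis (full_types) prod.collapse split_list)
    show ?thesis
    proof (cases "m = 0")
      case True
      have "peelings cell_le D (u @ v) = peelings cell_le E (u @ v)"
        by (rule less) (simp add: w)
      then show ?thesis using D E by (simp add: w True peelings_drop_zero)
    next
      case False
      then have m: "0 < m" by simp
      let ?x = "\<lambda>F i. (-1) ^ i * peelings cell_le F (u @ (False, i) # (True, m - i) # v)"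
      have IH: "?x D i = ?x E i" if "i < m" for i
        using that by (auto intro!: less simp: w)
      have spl: "(\<Sum>i\<le>m. ?x F i) = (\<Sum>i<m. ?x F i) + ?x F m" for F
        by (simp add: lessThan_Suc_atMost[symmetric])
      \<comment> \<open>In the term \<open>i = m\<close> the horizontal strip is empty and drops
        out, which leaves \<open>w\<close> itself; all other terms have smaller measure.\<close>
      have last: "?x F m = (-1) ^ m * peelings cell_le F w" if "finite F" for F
        using peelings_drop_zero[OF that, of cell_le "u @ [(False, m)]" True v] by (simp add: w)
      have "(\<Sum>i<m. ?x D i) = (\<Sum>i<m. ?x E i)"
        by (rule sum.cong) (use IH in auto)
      then have "?x D m = ?x E m"
        using peelings_alternating_sum[OF D m, of u v] peelings_alternating_sum[OF E m, of u v]
        unfolding spl by linarith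
      then show ?thesis unfolding last[OF D(1)] last[OF E(1)] by simp
    qed
  qed
qed

subsection \<open>Symmetry\<close>

text \<open>These are the free cells of Bender and Knuth. In the union of two consecutive horizontal
  strips, a column with two cells has the upper one in the first strip and the lower one in the
  second; only single cells can change strips.\<close>

definition lone :: "(nat \<times> nat) set \<Rightarrow> (nat \<times> nat) set" where
  "lone S = {x \<in> S. \<forall>y\<in>S. snd y = snd x \<longrightarrow> y = x}"

text \<open>Reflection of each row of \<open>S\<close> in its midpoint. For a cell of a finite
  \<open>S\<close> the subtraction on \<open>nat\<close> is not truncated.\<close>

definition flip :: "(nat \<times> nat) set \<Rightarrow> nat \<times> nat \<Rightarrow> nat \<times> nat" where
  "flip S x = (fst x, Min (row S (fst x)) + Max (row S (fst x)) - snd x)"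

lemma finite_row: "finite S \<Longrightarrow> finite (row S i)"
  by (rule finite_subset[of _ "snd ` S"]) (force simp: row_def)+

lemma fst_flip [simp]: "fst (flip S x) = fst x"
  by (simp add: flip_def)

lemma flip:
  assumes fin: "finite S"
    and int: "\<forall>i j m j'. (i, j) \<in> S \<longrightarrow> (i, j') \<in> S \<longrightarrow> j \<le> m \<longrightarrow> m \<le> j' \<longrightarrow> (i, m) \<in> S"
    and x: "x \<in> S"
  shows "flip S x \<in> S" "flip S (flip S x) = x"
    "\<And>y. y \<in> S \<Longrightarrow> fst x = fst y \<Longrightarrow> snd x \<le> snd y \<Longrightarrow> snd (flip S y) \<le> snd (flip S x)"
proof -
  let ?R = "row S (fst x)"
  have "snd x \<in> ?R" using x by (simp add: row_def)
  then have R: "finite ?R" "?R \<noteq> {}" using finite_row[OF fin] by auto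
  have mem: "(fst x, Min ?R) \<in> S" "(fst x, Max ?R) \<in> S"
    using Min_in[OF R] Max_in[OF R] by (auto simp: row_def)
  have bd: "Min ?R \<le> snd y" "snd y \<le> Max ?R" if "y \<in> S" "fst y = fst x" for y
  proof -
    have "snd y \<in> ?R" using that by (metis mem_Collect_eq prod.collapse row_def)
    then show "Min ?R \<le> snd y" "snd y \<le> Max ?R" using R by auto
  qed
  have b: "Min ?R \<le> snd x" "snd x \<le> Max ?R" using bd[OF x] by auto
  show "flip S x \<in> S" unfolding flip_def
    using b by (intro int[rule_format, OF mem]) auto
  show "flip S (flip S x) = x"
    using b by (cases x) (auto simp: flip_def)
  show "snd (flip S y) \<le> snd (flip S x)" if "y \<in> S" "fst x = fst y" "snd x \<le> snd y" for y
    using that by (auto simp: flip_def)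
qed

text \<open>The involution of Bender and Knuth on a pair of consecutive horizontal strips: in each row, the
  cells that are alone in their column form an interval, on which the two strips are reflected
  and exchanged.\<close>
definition bender_knuth ::
  "(nat \<times> nat) set \<times> (nat \<times> nat) set \<Rightarrow> (nat \<times> nat) set \<times> (nat \<times> nat) set" where
  "bender_knuth = (\<lambda>(A, B). let F = lone (A \<union> B) in
     ((A - F) \<union> flip F ` (B \<inter> F), (B - F) \<union> flip F ` (A \<inter> F)))"

text \<open>Outside \<open>F\<close> nothing moves, and there the columns pair the cells of
  \<open>A\<close> with those of \<open>B\<close>, so both strips have equally many. On
  \<open>F\<close> the reflection exchanges the two strips, so in total the sizes \<open>a\<close>
  and \<open>b\<close> are swapped.\<close>

lemma bender_knuth:
  assumes D: "finite D" and conv: "cell_convex D"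
    and A: "A \<in> strips cell_le D True a" and B: "B \<in> strips cell_le (D - A) True b"
    and bk: "bender_knuth (A, B) = (A', B')"
  shows "A' \<in> strips cell_le D True b" "B' \<in> strips cell_le (D - A') True a"
    "A' \<union> B' = A \<union> B" "bender_knuth (A', B') = (A, B)"
proof -
  note a = stripsD[OF A] and b = stripsD[OF B]
  define S where "S = A \<union> B"
  define F where "F = lone S"
  have fin: "finite A" "finite B" using D a(1) b(1) by (auto dest: finite_subset)
  then have finF: "finite F" by (auto simp: F_def S_def lone_def)
  have disj: "A \<inter> B = {}" using b(1) by blast
  have SD: "S \<subseteq> D" using a(1) b(1) by (auto simp: S_def)
  have FS: "F \<subseteq> S" by (auto simp: F_def lone_def)
  have A': "A' = (A - F) \<union> flip F ` (B \<inter> F)" and B': "B' = (B - F) \<union> flip F ` (A \<inter> F)"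
    using bk by (auto simp: bender_knuth_def Let_def F_def S_def)
  have Sdown: "y \<in> S" if "x \<in> S" "y \<in> D" "cell_le y x" for x y
    using that a(4)[of x y] b(4)[of x y] unfolding S_def by blast
  have loneD: "y = x" if "x \<in> F" "y \<in> S" "snd y = snd x" for x y
    using that by (auto simp: F_def lone_def)
  have colA: "x = y" if "x \<in> A" "y \<in> A" "snd x = snd y" for x y
    using a(3) that by (auto simp: line_of_def inj_on_def)
  have colB: "x = y" if "x \<in> B" "y \<in> B" "snd x = snd y" for x y
    using b(3) that by (auto simp: line_of_def inj_on_def)
  \<comment> \<open>A cell of \<open>S\<close> lower than a lone cell and weakly to its right would,
    by convexity and because \<open>S\<close> is initial, force a second cell into the lone cell's
    column. \<open>dn\<close> is the mirror case: higher and weakly to the left.\<close>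
  have up: False if "(i, j) \<in> F" "(i', j') \<in> S" "i < i'" "j \<le> j'" for i j i' j'
  proof -
    have "(i', j) \<in> D"
      by (rule cell_convexD[OF conv, of "(i, j)" "(i', j')"]) (use that FS SD in auto)
    then have "(i', j) \<in> S" using Sdown[of "(i', j')"] that by auto
    then show False using loneD[OF that(1)] that by fastforce
  qed
  have dn: False if "(i, j) \<in> F" "(i', j') \<in> S" "i' < i" "j' \<le> j" for i j i' j'
  proof -
    have "(i', j) \<in> D"
      by (rule cell_convexD[OF conv, of "(i', j')" "(i, j)"]) (use that FS SD in auto)
    then have "(i', j) \<in> S" using Sdown[of "(i, j)"] that FS by auto
    then show False using loneD[OF that(1)] that by fastforce
  qed
  have int: "(i, m) \<in> F" if j: "(i, j) \<in> F" "(i, j') \<in> F" "j \<le> m" "m \<le> j'" for i j m j'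
  proof -
    have "(i, m) \<in> D"
      by (rule cell_convexD[OF conv, of "(i, j)" "(i, j')"]) (use j FS SD in auto)
    then have m: "(i, m) \<in> S" using Sdown[of "(i, j')"] j FS by auto
    \<comment> \<open>A second cell in column \<open>m\<close> would be excluded by
      \<open>up\<close> at the left end \<open>(i, j)\<close> or by \<open>dn\<close> at the right
      end \<open>(i, j')\<close>.\<close>
    have only: "y = (i, m)" if "y \<in> S" "snd y = m" for y
    proof -
      have y: "(fst y, m) \<in> S" using that by auto
      have "fst y = i" using up[OF j(1) y] dn[OF j(2) y] j by (meson linorder_neqE_nat)
      then show ?thesis using that by auto
    qed
    show ?thesis unfolding F_def lone_def mem_Collect_eq snd_conv
      by (intro conjI ballI impI m only)
  qed
  have "\<forall>i j m j'. (i, j) \<in> F \<longrightarrow> (i, j') \<in> F \<longrightarrow> j \<le> m \<longrightarrow> m \<le> j' \<longrightarrow> (i, m) \<in> F"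
    using int by blast
  note fl = flip[OF finF this]
  have inv: "flip F ` flip F ` X = X" if "X \<subseteq> F" for X
    using fl(2) that by (force simp: image_image)
  have inF: "flip F ` X \<subseteq> F" if "X \<subseteq> F" for X using fl(1) that by blast
  have flipF: "flip F ` (A \<inter> F) \<union> flip F ` (B \<inter> F) = F"
  proof -
    have "flip F ` F = F" using inv[of F] inF[of F] by (metis image_mono subset_antisym subset_refl)
    moreover have "(A \<inter> F) \<union> (B \<inter> F) = F" using FS by (auto simp: S_def)
    ultimately show ?thesis by (metis image_Un)
  qed
  have injF: "inj_on (flip F) F" using fl(2) by (metis inj_onI)
  show U: "A' \<union> B' = A \<union> B"
    using flipF FS unfolding A' B' S_def by blast
  have dF: "flip F ` (A \<inter> F) \<inter> flip F ` (B \<inter> F) = {}"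
    using disj inj_on_image_Int[OF injF, of "A \<inter> F" "B \<inter> F"] by auto
  have disj': "A' \<inter> B' = {}"
    using disj dF inF[of "A \<inter> F"] inF[of "B \<inter> F"] unfolding A' B' by auto
  have A'F: "A' - F = A - F" "B' - F = B - F" "A' \<inter> F = flip F ` (B \<inter> F)" "B' \<inter> F = flip F ` (A \<inter> F)"
    using inF[of "A \<inter> F"] inF[of "B \<inter> F"] unfolding A' B' by auto
  show "bender_knuth (A', B') = (A, B)"
    unfolding bender_knuth_def using U
    by (auto simp: Let_def F_def[unfolded S_def, symmetric] A'F inv)
  have partnerA: "\<exists>y\<in>B - F. snd y = snd x" if x: "x \<in> A - F" for x
  proof -
    obtain y where y: "y \<in> S" "snd y = snd x" "y \<noteq> x"
      using x by (auto simp: F_def lone_def S_def)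
    then have "y \<in> B" using colA[of y x] x by (auto simp: S_def)
    moreover have "y \<notin> F" using loneD[of y x] y x by (auto simp: S_def)
    ultimately show ?thesis using y by blast
  qed
  have partnerB: "\<exists>y\<in>A - F. snd y = snd x" if x: "x \<in> B - F" for x
  proof -
    obtain y where y: "y \<in> S" "snd y = snd x" "y \<noteq> x"
      using x by (auto simp: F_def lone_def S_def)
    then have "y \<in> A" using colB[of y x] x by (auto simp: S_def)
    moreover have "y \<notin> F" using loneD[of y x] y x by (auto simp: S_def)
    ultimately show ?thesis using y by blast
  qed
  have "snd ` (A - F) = snd ` (B - F)"
  proof
    show "snd ` (A - F) \<subseteq> snd ` (B - F)"
    proof (rule image_subsetI)
      fix x assume "x \<in> A - F"
      from partnerA[OF this] obtain y where "y \<in> B - F" "snd x = snd y" by fastforce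
      then show "snd x \<in> snd ` (B - F)" by blast
    qed
    show "snd ` (B - F) \<subseteq> snd ` (A - F)"
    proof (rule image_subsetI)
      fix x assume "x \<in> B - F"
      from partnerB[OF this] obtain y where "y \<in> A - F" "snd x = snd y" by fastforce
      then show "snd x \<in> snd ` (A - F)" by blast
    qed
  qed
  moreover have "inj_on snd (A - F)" "inj_on snd (B - F)"
    using colA colB by (auto intro!: inj_onI)
  ultimately have cardF: "card (A - F) = card (B - F)"
    by (metis card_image)
  have cA: "card A = card (A - F) + card (A \<inter> F)" and cB: "card B = card (B - F) + card (B \<inter> F)"
    using fin by (metis card_Diff_subset_Int card_mono finite_Int inf_le1 le_add_diff_inverse2)+
  have cfl: "card (flip F ` (X \<inter> F)) = card (X \<inter> F)" for X
    by (rule card_image) (meson inf_le2 inj_on_subset injF)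
  have cA': "card A' = b" unfolding A'
    using fin inF[of "B \<inter> F"] cB cardF b(2) by (subst card_Un_disjoint) (auto simp: cfl)
  have cB': "card B' = a" unfolding B'
    using fin inF[of "A \<inter> F"] cA cardF a(2) by (subst card_Un_disjoint) (auto simp: cfl)
  show "A' \<in> strips cell_le D True b"
  proof (rule stripsI)
    show "A' \<subseteq> D" using U SD unfolding S_def by blast
    show "card A' = b" by (rule cA')
    show "x = y" if "x \<in> A'" "y \<in> A'" "line_of True x = line_of True y" for x y
    proof -
      have s: "x \<in> S" "y \<in> S" "snd x = snd y" using that U by (auto simp: S_def line_of_def)
      show ?thesis
      proof (cases "x \<in> F \<or> y \<in> F")
        case True then show ?thesis using loneD[of x y] loneD[of y x] s by auto
      next
        case False then have "x \<in> A" "y \<in> A" using that A'F by auto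
        then show ?thesis using colA s by blast
      qed
    qed
    show "y \<in> A'" if x: "x \<in> A'" and y: "y \<in> D" "cell_le y x" for x y
    proof -
      have xS: "x \<in> S" using x U by (auto simp: S_def)
      have yS: "y \<in> S" using Sdown[OF xS y] .
      obtain i j i' j' where e: "x = (i, j)" "y = (i', j')" by (cases x, cases y)
      have le: "i' \<le> i" "j' \<le> j" using y e by auto
      show ?thesis
      proof (cases "x \<in> F")
        case False
        then have xA: "x \<in> A - F" using x A'F by blast
        then have yA: "y \<in> A" using a(4) y by blast
        \<comment> \<open>The partner of \<open>x\<close> lies in \<open>B\<close>, hence below
          \<open>x\<close>. It is then lower than \<open>y\<close> and weakly to its right, so
          \<open>y\<close> is not lone.\<close>
        obtain k where k: "(k, j) \<in> B" using partnerA[OF xA] e by force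
        have "\<not> k \<le> i"
        proof
          assume "k \<le> i"
          then have "(k, j) \<in> A" using a(4)[of x "(k, j)"] xA k b(1) e by auto
          then show False using disj k by blast
        qed
        then have "y \<notin> F" using up[of i' j' k j] k le e by (auto simp: S_def)
        then show ?thesis using yA A'F by blast
      next
        case True
        have i': "i' = i" using dn[of i j i' j'] True yS e le by fastforce
        have "x \<in> flip F ` (B \<inter> F)" using True x A'F(3) by blast
        then obtain z where z: "z \<in> B \<inter> F" "x = flip F z" by blast
        have xB: "flip F x \<in> B \<inter> F" using z(1) fl(2)[of z] unfolding z(2) by simp
        show ?thesis
        proof (cases "y \<in> F")
          case yF: True
          \<comment> \<open>The reflection reverses the order in the row: \<open>y\<close> before
            \<open>x\<close> becomes \<open>flip F y\<close> after \<open>flip F x\<close>, and the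
            latter is already outside the initial set \<open>A\<close>.\<close>
          have "snd (flip F x) \<le> snd (flip F y)"
            using fl(3)[OF yF True] e i' le by simp
          then have "cell_le (flip F x) (flip F y)" using e i' by (simp add: cell_le_def)
          moreover have "flip F x \<notin> A" using xB disj by blast
          moreover have "flip F x \<in> D" using xB b(1) by blast
          ultimately have "flip F y \<notin> A" using a(4) by blast
          then have "flip F y \<in> B \<inter> F" using fl(1)[OF yF] FS by (auto simp: S_def)
          then show ?thesis using A'F(3) fl(2)[OF yF] by (metis IntD1 image_eqI)
        next
          case yF: False
          have "y \<in> A"
          proof (rule ccontr)
            assume "y \<notin> A"
            then have "y \<in> B - F" using yS yF by (auto simp: S_def)
            \<comment> \<open>The partner of \<open>y\<close> in \<open>A\<close> would lie above
              \<open>y\<close>, hence in a higher row than the lone cell \<open>x\<close> and weakly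
              to its left, contradicting \<open>dn\<close>.\<close>
            then obtain k where k: "(k, j') \<in> A" using partnerB e by force
            have "\<not> i' \<le> k"
              using a(4)[OF k, of y] y(1) \<open>y \<notin> A\<close> e by auto
            then show False using dn[of i j k j'] True k e le i' by (auto simp: S_def)
          qed
          then show ?thesis using yF A'F by blast
        qed
      qed
    qed
  qed
  show "B' \<in> strips cell_le (D - A') True a"
  proof (rule stripsI)
    show "B' \<subseteq> D - A'" using U SD disj' unfolding S_def by blast
    show "card B' = a" by (rule cB')
    show "x = y" if "x \<in> B'" "y \<in> B'" "line_of True x = line_of True y" for x y
    proof -
      have s: "x \<in> S" "y \<in> S" "snd x = snd y" using that U by (auto simp: S_def line_of_def)
      show ?thesis
      proof (cases "x \<in> F \<or> y \<in> F")
        case True then show ?thesis using loneD[of x y] loneD[of y x] s by auto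
      next
        case False then have "x \<in> B" "y \<in> B" using that A'F by auto
        then show ?thesis using colB s by blast
      qed
    qed
    show "y \<in> B'" if "x \<in> B'" "y \<in> D - A'" "cell_le y x" for x y
      using Sdown[of x y] that U by (auto simp: S_def)
  qed
qed

lemma Diff_Diff_eq_Un: "A - B - C = A - (B \<union> C)"
  by blast

lemma peelings_two:
  assumes "finite D"
  shows "peelings r D ((t, a) # (t', b) # w) =
    (\<Sum>(A, B)\<in>(SIGMA A:strips r D t a. strips r (D - A) t' b). peelings r (D - A - B) w)"
  using assms by (simp add: sum.Sigma finite_strips)

text \<open>The involution \<open>bender_knuth\<close> reindexes the pairs of strips and preserves
  their union, so the cells left for \<open>w\<close> are the same.\<close>

lemma peelings_swap:
  assumes "finite D" "cell_convex D"
  shows "peelings cell_le D (u @ (True, a) # (True, b) # w) =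
    peelings cell_le D (u @ (True, b) # (True, a) # w)"
  using assms
proof (induction u arbitrary: D)
  case Nil
  note bk = bender_knuth[OF Nil]
  have bk1: "bender_knuth p \<in> (SIGMA A:strips cell_le D True b. strips cell_le (D - A) True a)
      \<and> bender_knuth (bender_knuth p) = p
      \<and> fst (bender_knuth p) \<union> snd (bender_knuth p) = fst p \<union> snd p"
    if "p \<in> (SIGMA A:strips cell_le D True a. strips cell_le (D - A) True b)" for p a b
  proof -
    obtain A B where p: "p = (A, B)" by (cases p)
    obtain A' B' where e: "bender_knuth (A, B) = (A', B')" by (cases "bender_knuth (A, B)")
    show ?thesis using that bk[OF _ _ e, of a b] by (auto simp: p e)
  qed
  show ?case unfolding append_Nil peelings_two[OF Nil(1)]
    by (rule sum.reindex_bij_witness[of _ bender_knuth bender_knuth])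
      (use bk1 in \<open>auto simp: Diff_Diff_eq_Un case_prod_unfold\<close>)
next
  case (Cons p u)
  obtain t n where p: "p = (t, n)" by (cases p)
  show ?case unfolding p using Cons cell_convex_diff
    by (auto intro!: sum.cong)
qed

text \<open>Exchanges of neighbours suffice: \<open>move\<close> carries one strip past all later
  ones, and iterating it reverses the word.\<close>

lemma peelings_rev:
  assumes D: "finite D" "cell_convex D"
  shows "peelings cell_le D (rev (map (Pair True) ns)) = peelings cell_le D (map (Pair True) ns)"
proof -
  have move: "peelings cell_le D (u @ (True, n) # map (Pair True) ns)
      = peelings cell_le D (u @ map (Pair True) ns @ [(True, n)])" for u n ns
  proof (induction ns arbitrary: u)
    case (Cons m ns)
    show ?case using Cons[of "u @ [(True, m)]"] peelings_swap[OF D, of u n m] by simp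
  qed simp
  have "peelings cell_le D (u @ rev (map (Pair True) ns)) = peelings cell_le D (u @ map (Pair True) ns)" for u
  proof (induction ns arbitrary: u)
    case (Cons m ns)
    show ?case using Cons[of "u @ [(True, m)]"] move[of u m "rev ns"] by (simp add: rev_map)
  qed simp
  from this[of "[]"] show ?thesis by simp
qed

section \<open>Peeling from the opposite end, and transport along maps of cells\<close>

lemma strips_converse_iff:
  "(A \<in> strips r D t m \<and> H \<in> strips (\<lambda>x y. r y x) (D - A) t' n) \<longleftrightarrow>
   (H \<in> strips (\<lambda>x y. r y x) D t' n \<and> A \<in> strips r (D - H) t m)"
  unfolding strips_def mem_Collect_eq by blast

text \<open>The strip peeled last is closed under the converse order. By
  \<open>strips_converse_iff\<close>, an initial and a final strip can be removed in either order,
  so the last one may just as well come off first.\<close>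

lemma peelings_snoc:
  assumes "finite D"
  shows "peelings r D (w @ [(t, n)]) = (\<Sum>H\<in>strips (\<lambda>x y. r y x) D t n. peelings r (D - H) w)"
  using assms
proof (induction w arbitrary: D)
  case Nil
  \<comment> \<open>Only \<open>A = D\<close> contributes, and the closure condition on
    \<open>D\<close> within itself is vacuous, so both orders give the same value.\<close>
  have "(\<Sum>A\<in>strips r' D t n. peelings r (D - A) []) =
     (if card D = n \<and> inj_on (line_of t) D then 1 else 0)" for r' :: "nat \<times> nat \<Rightarrow> nat \<times> nat \<Rightarrow> bool"
  proof -
    have "(\<Sum>A\<in>strips r' D t n. peelings r (D - A) []) = (\<Sum>A\<in>strips r' D t n. if A = D then 1 else 0)"
      by (rule sum.cong) (auto simp: strips_def)
    also have "\<dots> = (if D \<in> strips r' D t n then 1 else 0)"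
      using Nil by (simp add: finite_strips)
    finally show ?thesis by (simp add: strips_def)
  qed
  then show ?case by simp
next
  case (Cons p w)
  obtain s m where p: "p = (s, m)" by (cases p)
  let ?X = "SIGMA A:strips r D s m. strips (\<lambda>x y. r y x) (D - A) t n"
  let ?Y = "SIGMA H:strips (\<lambda>x y. r y x) D t n. strips r (D - H) s m"
  have "peelings r D ((p # w) @ [(t, n)]) = (\<Sum>(A, H)\<in>?X. peelings r (D - A - H) w)"
    using Cons by (simp add: p sum.Sigma finite_strips)
  also have "\<dots> = (\<Sum>(H, A)\<in>?Y. peelings r (D - H - A) w)"
    by (rule sum.reindex_bij_witness[of _ "\<lambda>(a, b). (b, a)" "\<lambda>(a, b). (b, a)"])
      (use strips_converse_iff[of _ r D s m _ t n] in \<open>auto simp: Diff_Diff_eq_Un Un_commute\<close>)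
  also have "\<dots> = (\<Sum>H\<in>strips (\<lambda>x y. r y x) D t n. peelings r (D - H) (p # w))"
    using Cons by (simp add: p sum.Sigma finite_strips)
  finally show ?case .
qed

lemma peelings_converse:
  "finite D \<Longrightarrow> peelings (\<lambda>x y. r y x) D w = peelings r D (rev w)"
proof (induction w arbitrary: D)
  case (Cons p w)
  then show ?case by (cases p) (simp add: peelings_snoc)
qed simp

text \<open>This serves translations, which preserve \<open>cell_le\<close>, and rotations, for
  which \<open>r'\<close> is the converse of \<open>cell_le\<close>.\<close>

lemma peelings_image:
  assumes "inj_on f D" "\<And>x y. x \<in> D \<Longrightarrow> y \<in> D \<Longrightarrow> r' (f x) (f y) \<longleftrightarrow> r x y"
    and "\<And>t x y. x \<in> D \<Longrightarrow> y \<in> D \<Longrightarrow> line_of t (f x) = line_of t (f y) \<longleftrightarrow> line_of t x = line_of t y"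
  shows "peelings r' (f ` D) w = peelings r D w"
  using assms
proof (induction w arbitrary: D)
  case (Cons p w)
  obtain t n where p: "p = (t, n)" by (cases p)
  have sub: "(f ` A \<in> strips r' (f ` D) t n) = (A \<in> strips r D t n)" if "A \<subseteq> D" for A
  proof -
    have "card (f ` A) = card A" using Cons.prems(1) that by (meson card_image inj_on_subset)
    moreover have "inj_on (line_of t) (f ` A) \<longleftrightarrow> inj_on (line_of t) A"
    proof -
      have "line_of t (f x) = line_of t (f y) \<longleftrightarrow> line_of t x = line_of t y" "f x = f y \<longleftrightarrow> x = y"
        if "x \<in> A" "y \<in> A" for x y
        using that \<open>A \<subseteq> D\<close> Cons.prems(3) inj_on_eq_iff[OF Cons.prems(1)] by blast+
      then show ?thesis by (simp add: inj_on_def cong: ball_cong)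
    qed
    moreover have "(\<forall>x\<in>f ` A. \<forall>y\<in>f ` D. r' y x \<longrightarrow> y \<in> f ` A) \<longleftrightarrow> (\<forall>x\<in>A. \<forall>y\<in>D. r y x \<longrightarrow> y \<in> A)"
    proof -
      have "r' (f y) (f x) \<longleftrightarrow> r y x" "f y \<in> f ` A \<longleftrightarrow> y \<in> A" if "x \<in> A" "y \<in> D" for x y
        using that \<open>A \<subseteq> D\<close> Cons.prems(2) inj_on_image_mem_iff[OF Cons.prems(1)] by blast+
      then show ?thesis by (simp cong: ball_cong)
    qed
    ultimately show ?thesis using that unfolding strips_def by auto
  qed
  have im: "strips r' (f ` D) t n = (\<lambda>A. f ` A) ` strips r D t n"
  proof
    show "(\<lambda>A. f ` A) ` strips r D t n \<subseteq> strips r' (f ` D) t n"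
      using sub[OF stripsD(1)] by (intro image_subsetI) simp
    show "strips r' (f ` D) t n \<subseteq> (\<lambda>A. f ` A) ` strips r D t n"
    proof
      fix X assume X: "X \<in> strips r' (f ` D) t n"
      obtain A where A: "A \<subseteq> D" "X = f ` A" using stripsD(1)[OF X] by (rule subset_imageE)
      then show "X \<in> (\<lambda>A. f ` A) ` strips r D t n" using sub[OF A(1)] X by simp
    qed
  qed
  have inj: "inj_on (\<lambda>A. f ` A) (strips r D t n)"
    by (rule inj_onI) (simp add: inj_on_image_eq_iff[OF Cons.prems(1) stripsD(1) stripsD(1)])
  have "peelings r' (f ` D - f ` A) w = peelings r (D - A) w" if "A \<in> strips r D t n" for A
  proof -
    have "f ` D - f ` A = f ` (D - A)"
      using inj_on_image_set_diff[OF Cons.prems(1), of D A] stripsD(1)[OF that] by auto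
    moreover have "peelings r' (f ` (D - A)) w = peelings r (D - A) w"
      by (rule Cons.IH) (use Cons.prems in \<open>auto intro: inj_on_diff\<close>)
    ultimately show ?thesis by simp
  qed
  then show ?case by (simp add: p im sum.reindex[OF inj])
qed simp

subsection \<open>Tableaux as peelings\<close>

text \<open>Entries of tableaux start at 1, so position \<open>i\<close> of the list holds the
  multiplicity of \<open>Suc i\<close>, and the multiplicity of 0 is 0.\<close>

definition content_of :: "nat list \<Rightarrow> nat \<Rightarrow> nat" where
  "content_of ns k = (case k of 0 \<Rightarrow> 0 | Suc i \<Rightarrow> part ns i)"

lemma content_of_simps [simp]:
  "content_of ns 0 = 0" "content_of [] k = 0" "content_of (n # ns) (Suc 0) = n"
  "content_of (n # ns) (Suc (Suc i)) = content_of ns (Suc i)"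
  by (auto simp: content_of_def part_def split: nat.splits)

lemma content_of_exists:
  assumes "finite {k. alpha k \<noteq> 0}" "alpha 0 = 0"
  shows "\<exists>ns. alpha = content_of ns"
proof -
  obtain N where "\<forall>k\<in>{k. alpha k \<noteq> 0}. k \<le> N"
    using assms(1) finite_nat_set_iff_bounded_le by blast
  then have N: "alpha k = 0" if "N < k" for k using that by fastforce
  have "alpha k = content_of (map (\<lambda>i. alpha (Suc i)) [0..<N]) k" for k
    using assms(2) N by (auto simp: content_of_def part_def split: nat.splits)
  then show ?thesis by blast
qed

text \<open>Convexity supplies the cell \<open>(i, j')\<close>, through which one goes along a row
  and then down a column.\<close>

lemma ssyt_mono:
  assumes "cell_convex D" "ssyt D T" "x \<in> D" "y \<in> D" "cell_le x y"
  shows "T x \<le> T y"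
proof -
  obtain i j i' j' where e: "x = (i, j)" "y = (i', j')" by (cases x, cases y)
  have le: "i \<le> i'" "j \<le> j'" using assms e by auto
  have m: "(i, j') \<in> D"
    by (rule cell_convexD[OF assms(1,3,4)]) (use e le in auto)
  have "T (i, j) \<le> T (i, j')"
    using assms(2,3) m le e unfolding ssyt_def by (cases "j = j'") auto
  also have "\<dots> \<le> T (i', j')"
  proof (cases "i = i'")
    case False
    then have "i < i'" using le by simp
    then show ?thesis using assms(2,4) m e unfolding ssyt_def by (meson less_imp_le)
  qed simp
  finally show ?thesis using e by simp
qed

lemma ssytD:
  assumes "ssyt D T"
  shows "\<And>c. c \<notin> D \<Longrightarrow> T c = 0" "\<And>c. c \<in> D \<Longrightarrow> 1 \<le> T c"
    "\<And>i j j'. (i, j) \<in> D \<Longrightarrow> (i, j') \<in> D \<Longrightarrow> j < j' \<Longrightarrow> T (i, j) \<le> T (i, j')"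
    "\<And>i i' j. (i, j) \<in> D \<Longrightarrow> (i', j) \<in> D \<Longrightarrow> i < i' \<Longrightarrow> T (i, j) < T (i', j)"
  using assms unfolding ssyt_def by blast+

lemma ssytI:
  assumes "\<And>c. c \<notin> D \<Longrightarrow> T c = 0" "\<And>c. c \<in> D \<Longrightarrow> 1 \<le> T c"
    "\<And>i j j'. (i, j) \<in> D \<Longrightarrow> (i, j') \<in> D \<Longrightarrow> j < j' \<Longrightarrow> T (i, j) \<le> T (i, j')"
    "\<And>i i' j. (i, j) \<in> D \<Longrightarrow> (i', j) \<in> D \<Longrightarrow> i < i' \<Longrightarrow> T (i, j) < T (i', j)"
  shows "ssyt D T"
  using assms unfolding ssyt_def by blast

definition tableaux :: "(nat \<times> nat) set \<Rightarrow> nat list \<Rightarrow> (nat \<times> nat \<Rightarrow> nat) set" where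
  "tableaux D ns = {T. ssyt D T \<and> content D T = content_of ns}"

lemma tableaux_remove_ones:
  assumes conv: "cell_convex D" and T: "T \<in> tableaux D (n # ns)"
  defines "A \<equiv> {c \<in> D. T c = 1}"
  shows "A \<in> strips cell_le D True n" "(\<lambda>c. T c - 1) \<in> tableaux (D - A) ns"
proof -
  have s: "ssyt D T" and cont: "\<And>k. content D T k = content_of (n # ns) k"
    using T by (auto simp: tableaux_def)
  note sD = ssytD[OF s]
  show "A \<in> strips cell_le D True n"
  proof (rule stripsI)
    show "A \<subseteq> D" by (auto simp: A_def)
    show "card A = n" using cont[of 1] by (simp add: content_def A_def)
    show "x = y" if xy: "x \<in> A" "y \<in> A" "line_of True x = line_of True y" for x y
    proof -
      obtain i j i' where e: "x = (i, j)" "y = (i', j)" using xy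
        by (cases x, cases y) (auto simp: line_of_def)
      then show ?thesis using sD(4)[of i j i'] sD(4)[of i' j i] xy
        by (cases i i' rule: linorder_cases) (auto simp: A_def)
    qed
    show "y \<in> A" if "x \<in> A" "y \<in> D" "cell_le y x" for x y
      using ssyt_mono[OF conv s that(2) _ that(3)] sD(2)[of y] that by (auto simp: A_def)
  qed
  have two: "2 \<le> T c" if "c \<in> D - A" for c using sD(2)[of c] that by (auto simp: A_def)
  have "ssyt (D - A) (\<lambda>c. T c - 1)"
  proof (rule ssytI)
    show "T c - 1 = 0" if "c \<notin> D - A" for c
      using that sD(1)[of c] by (auto simp: A_def)
    show "1 \<le> T c - 1" if "c \<in> D - A" for c using two[OF that] by simp
    show "T (i, j) - 1 \<le> T (i, j') - 1" if "(i, j) \<in> D - A" "(i, j') \<in> D - A" "j < j'" for i j j'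
      using sD(3)[of i j j'] that by (auto simp: diff_le_mono)
    show "T (i, j) - 1 < T (i', j) - 1" if "(i, j) \<in> D - A" "(i', j) \<in> D - A" "i < i'" for i i' j
      using sD(4)[of i j i'] two[OF that(1)] that by auto
  qed
  moreover have "content (D - A) (\<lambda>c. T c - 1) k = content_of ns k" for k
  proof (cases k)
    case 0
    have "{c \<in> D - A. T c - 1 = 0} = {}" using two by fastforce
    then show ?thesis unfolding content_def 0 by (metis card.empty content_of_simps(1))
  next
    case (Suc i)
    have "{c \<in> D - A. T c - 1 = Suc i} = {c \<in> D. T c = Suc (Suc i)}" by (auto simp: A_def)
    then show ?thesis using cont[of "Suc (Suc i)"] unfolding content_def Suc by simp
  qed
  ultimately show "(\<lambda>c. T c - 1) \<in> tableaux (D - A) ns" by (auto simp: tableaux_def)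
qed

lemma tableaux_add_ones:
  assumes A: "A \<in> strips cell_le D True n" and T: "T \<in> tableaux (D - A) ns"
  shows "(\<lambda>c. if c \<in> D then Suc (T c) else 0) \<in> tableaux D (n # ns)" (is "?T \<in> _")
    and "{c \<in> D. T c = 0} = A"
proof -
  have s: "ssyt (D - A) T" and cont: "\<And>k. content (D - A) T k = content_of ns k"
    using T by (auto simp: tableaux_def)
  note sD = ssytD[OF s] and a = stripsD[OF A]
  have col: "i = i'" if "(i, j) \<in> A" "(i', j) \<in> A" for i i' j
    using inj_onD[OF a(3), of "(i, j)" "(i', j)"] that by (simp add: line_of_def)
  have T0: "T c = 0" if "c \<in> A" for c using sD(1) that by auto
  show ones: "{c \<in> D. T c = 0} = A"
  proof -
    have "T c \<noteq> 0" if "c \<in> D - A" for c using sD(2)[OF that] by simp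
    then show ?thesis using a(1) T0 by blast
  qed
  have "ssyt D ?T"
  proof (rule ssytI)
    show "?T (i, j) \<le> ?T (i, j')" if "(i, j) \<in> D" "(i, j') \<in> D" "j < j'" for i j j'
    proof (cases "(i, j) \<in> A")
      case False
      then have "(i, j') \<notin> A" using a(4)[of "(i, j')" "(i, j)"] that by auto
      then show ?thesis using False that sD(3)[of i j j'] by simp
    qed (use that T0 in simp)
    show "?T (i, j) < ?T (i', j)" if "(i, j) \<in> D" "(i', j) \<in> D" "i < i'" for i i' j
    proof -
      have nA: "(i', j) \<notin> A"
      proof
        assume h: "(i', j) \<in> A"
        then have "(i, j) \<in> A" using a(4)[OF h that(1)] that by simp
        then show False using col h that by blast
      qed
      show ?thesis
      proof (cases "(i, j) \<in> A")
        case True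
        then show ?thesis using that T0 sD(2)[of "(i', j)"] nA by simp
      qed (use nA that sD(4)[of i j i'] in simp)
    qed
  qed auto
  moreover have "content D ?T k = content_of (n # ns) k" for k
  proof -
    consider "k = 0" | "k = 1" | i where "k = Suc (Suc i)" by (metis One_nat_def not0_implies_Suc)
    then show ?thesis
    proof cases
      case 1
      then show ?thesis by (simp add: content_def)
    next
      case 2
      then have "{c \<in> D. ?T c = k} = A" using ones by auto
      then show ?thesis using 2 a(2) by (simp add: content_def)
    next
      case 3
      then have "{c \<in> D. ?T c = k} = {c \<in> D - A. T c = Suc i}" using T0 by auto
      then show ?thesis using 3 cont[of "Suc i"] by (simp add: content_def)
    qed
  qed
  ultimately show "?T \<in> tableaux D (n # ns)" by (auto simp: tableaux_def)
qed

text \<open>Removing the ones and lowering the other entries is a bijection onto pairs of a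
  horizontal strip and a tableau on the rest, which is the recursion of
  \<open>peelings\<close>.\<close>

lemma card_tableaux:
  assumes "finite D" "cell_convex D"
  shows "finite (tableaux D ns) \<and> int (card (tableaux D ns)) = peelings cell_le D (map (Pair True) ns)"
  using assms
proof (induction ns arbitrary: D)
  case Nil
  show ?case
  proof (cases "D = {}")
    case True
    then have "tableaux D [] = {\<lambda>_. 0}"
      by (auto simp: tableaux_def ssyt_def content_def fun_eq_iff)
    then show ?thesis using True by simp
  next
    case False
    then obtain c where c: "c \<in> D" by blast
    have "content D T (T c) \<noteq> 0" for T
    proof -
      have "c \<in> {x \<in> D. T x = T c}" using c by simp
      moreover have "finite {x \<in> D. T x = T c}" using Nil(1) by simp
      ultimately show ?thesis unfolding content_def using card_0_eq by blast
    qed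
    then have "content D T \<noteq> content_of []" for T by (metis content_of_simps(2))
    then have "tableaux D [] = {}" by (simp add: tableaux_def)
    then show ?thesis using False by simp
  qed
next
  case (Cons n ns)
  let ?S = "SIGMA A:strips cell_le D True n. tableaux (D - A) ns"
  let ?f = "\<lambda>T. ({c \<in> D. T c = 1}, \<lambda>c. T c - 1)"
  \<comment> \<open>A tableau on \<open>D - A\<close> vanishes on the strip \<open>A\<close>, so
    raising by one restores exactly the entries 1 there.\<close>
  let ?g = "\<lambda>(A, T) c. if c \<in> D then Suc (T c) else 0"
  have IH: "finite (tableaux (D - A) ns)"
    "int (card (tableaux (D - A) ns)) = peelings cell_le (D - A) (map (Pair True) ns)"
    if "A \<in> strips cell_le D True n" for A
    using Cons.IH[of "D - A"] Cons.prems cell_convex_diff[OF _ that] by auto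
  have bij: "bij_betw ?f (tableaux D (n # ns)) ?S"
  proof (rule bij_betw_byWitness[where f' = ?g])
    show "\<forall>T\<in>tableaux D (n # ns). ?g (?f T) = T"
    proof
      fix T assume "T \<in> tableaux D (n # ns)"
      then have "ssyt D T" by (simp add: tableaux_def)
      from ssytD(1,2)[OF this] show "?g (?f T) = T" by (fastforce simp: fun_eq_iff)
    qed
    show "\<forall>p\<in>?S. ?f (?g p) = p"
    proof
      fix p assume "p \<in> ?S"
      then obtain A T where p: "p = (A, T)" "A \<in> strips cell_le D True n" "T \<in> tableaux (D - A) ns"
        by blast
      have "T c = 0" if "c \<notin> D" for c
        using p(3) ssytD(1)[of "D - A" T c] that by (auto simp: tableaux_def)
      then show "?f (?g p) = p" using tableaux_add_ones(2)[OF p(2,3)] by (auto simp: p fun_eq_iff)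
    qed
    show "?f ` tableaux D (n # ns) \<subseteq> ?S"
      using tableaux_remove_ones[OF Cons.prems(2)] by blast
    show "?g ` ?S \<subseteq> tableaux D (n # ns)"
      using tableaux_add_ones(1) by auto
  qed
  have fin: "finite ?S" using finite_strips[OF Cons.prems(1)] IH by blast
  have "int (card ?S) = peelings cell_le D (map (Pair True) (n # ns))"
    using finite_strips[OF Cons.prems(1)] IH by simp
  then show ?case unfolding bij_betw_same_card[OF bij, symmetric]
    using bij_betw_finite[OF bij] fin by blast
qed

text \<open>A finitely supported exponent is given by a list if it vanishes at 0; otherwise its
  coefficient is 0 for both shapes, since no entry is 0.\<close>

lemma schur_eq_iff_peelings:
  assumes D: "finite D" "cell_convex D" and E: "finite E" "cell_convex E"
  shows "schur_eq D E \<longleftrightarrow>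
    (\<forall>ns. peelings cell_le D (map (Pair True) ns) = peelings cell_le E (map (Pair True) ns))"
proof -
  have coeff: "int (schur_coeff F (content_of ns)) = peelings cell_le F (map (Pair True) ns)"
    if "finite F" "cell_convex F" for F ns
    using card_tableaux[OF that] by (simp add: schur_coeff_def tableaux_def)
  have coeff0: "schur_coeff F alpha = 0" if "alpha 0 \<noteq> 0" for F alpha
  proof -
    have "content F T 0 = 0" if "ssyt F T" for T
    proof -
      have "{c \<in> F. T c = 0} = {}" using ssytD(2)[OF that] by fastforce
      then show ?thesis unfolding content_def by (metis card.empty)
    qed
    then have "{T. ssyt F T \<and> content F T = alpha} = {}" using that by fastforce
    then show ?thesis unfolding schur_coeff_def by (metis card.empty)
  qed
  show ?thesis
  proof
    assume eq: "schur_eq D E"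
    show "\<forall>ns. peelings cell_le D (map (Pair True) ns) = peelings cell_le E (map (Pair True) ns)"
    proof
      fix ns
      have "content_of ns k = 0" if "length ns < k" for k
        using that by (cases k) (auto simp: content_of_def part_def)
      then have "{k. content_of ns k \<noteq> 0} \<subseteq> {..length ns}"
        by (auto simp: not_less[symmetric])
      then have "finite {k. content_of ns k \<noteq> 0}" using finite_subset by blast
      then show "peelings cell_le D (map (Pair True) ns) = peelings cell_le E (map (Pair True) ns)"
        using eq coeff[OF D, of ns] coeff[OF E, of ns] by (simp add: schur_eq_def)
    qed
  next
    assume eq: "\<forall>ns. peelings cell_le D (map (Pair True) ns) = peelings cell_le E (map (Pair True) ns)"
    show "schur_eq D E" unfolding schur_eq_def
    proof (intro allI impI)
      fix alpha :: "nat \<Rightarrow> nat" assume fin: "finite {k. alpha k \<noteq> 0}"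
      show "schur_coeff D alpha = schur_coeff E alpha"
      proof (cases "alpha 0 = 0")
        case True
        then obtain ns where "alpha = content_of ns" using content_of_exists[OF fin] by blast
        then show ?thesis using coeff[OF D, of ns] coeff[OF E, of ns] eq by simp
      qed (simp add: coeff0)
    qed
  qed
qed

subsection \<open>Row and column lengths\<close>

definition line_len :: "bool \<Rightarrow> (nat \<times> nat) set \<Rightarrow> nat \<Rightarrow> nat" where
  "line_len t D l = card {c \<in> D. line_of t c = l}"

text \<open>For positive \<open>k\<close> this is the conjugate of the partition formed by the line
  lengths. For \<open>k = 0\<close> the set is infinite and its \<open>card\<close> is 0, hence the
  \<open>Suc k\<close> in later statements.\<close>

definition long_lines :: "bool \<Rightarrow> (nat \<times> nat) set \<Rightarrow> nat \<Rightarrow> nat" where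
  "long_lines t D k = card {l. k \<le> line_len t D l}"

text \<open>Summation by parts: any sum of a function of the lengths depends on the lengths only
  through the level counts.\<close>

lemma sum_over_levels:
  fixes F :: "nat \<Rightarrow> int"
  assumes "\<And>l. r l \<le> K" "\<And>l. M \<le> l \<Longrightarrow> r l = 0"
  shows "(\<Sum>l<M. F (r l)) = int M * F 0 + (\<Sum>k<K. (F (Suc k) - F k) * int (card {l. Suc k \<le> r l}))"
proof -
  have tele: "F n = F 0 + (\<Sum>k<K. if k < n then F (Suc k) - F k else 0)" if "n \<le> K" for n
  proof -
    have "(\<Sum>k<K. if k < n then F (Suc k) - F k else 0) = (\<Sum>k<n. F (Suc k) - F k)"
      using that by (intro sum.mono_neutral_cong_right) auto
    then show ?thesis by (simp add: sum_lessThan_telescope)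
  qed
  have level: "(\<Sum>l<M. if k < r l then x else 0) = x * int (card {l. Suc k \<le> r l})" for k x
  proof -
    have "{l. Suc k \<le> r l} \<subseteq> {..<M}" using assms(2) by (fastforce simp: not_le[symmetric])
    then have "{l \<in> {..<M}. k < r l} = {l. Suc k \<le> r l}" by (auto simp: Suc_le_eq)
    then show ?thesis by (simp add: sum.If_cases Int_def)
  qed
  have "(\<Sum>l<M. F (r l)) = (\<Sum>l<M. F 0 + (\<Sum>k<K. if k < r l then F (Suc k) - F k else 0))"
    by (intro sum.cong refl tele assms(1))
  also have "\<dots> = int M * F 0 + (\<Sum>l<M. \<Sum>k<K. if k < r l then F (Suc k) - F k else 0)"
    by (simp add: sum.distrib)
  also have "\<dots> = int M * F 0 + (\<Sum>k<K. \<Sum>l<M. if k < r l then F (Suc k) - F k else 0)"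
    by (subst sum.swap) simp
  finally show ?thesis by (simp add: level)
qed

lemma sum_min_eq_sum_levels:
  fixes r :: "nat \<Rightarrow> nat"
  assumes "\<And>l. M \<le> l \<Longrightarrow> r l = 0"
  shows "(\<Sum>l<M. min k (r l)) = (\<Sum>i<k. card {l. Suc i \<le> r l})"
proof (induction k)
  case (Suc k)
  have "{l. Suc k \<le> r l} \<subseteq> {..<M}" using assms by (fastforce simp: not_le[symmetric])
  then have "{l \<in> {..<M}. Suc k \<le> r l} = {l. Suc k \<le> r l}" by auto
  then have "card {l. Suc k \<le> r l} = (\<Sum>l<M. if Suc k \<le> r l then 1 else 0)"
    by (simp add: sum.If_cases Int_def)
  moreover have "min (Suc k) (r l) = min k (r l) + (if Suc k \<le> r l then 1 else 0)" for l
    by auto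
  ultimately show ?case using Suc by (simp add: sum.distrib)
qed simp

section \<open>Dominance bounds for the sizes of strips\<close>

lemma line_len_diff:
  assumes "finite D" "A \<subseteq> D"
  shows "line_len t (D - A) l = line_len t D l - line_len t A l"
proof -
  have "{c \<in> D - A. line_of t c = l} = {c \<in> D. line_of t c = l} - {c \<in> A. line_of t c = l}"
    by auto
  moreover have "finite {c \<in> A. line_of t c = l}" using finite_subset[OF assms(2,1)] by simp
  moreover have "{c \<in> A. line_of t c = l} \<subseteq> {c \<in> D. line_of t c = l}" using assms(2) by blast
  ultimately show ?thesis unfolding line_len_def by (simp add: card_Diff_subset)
qed

lemma line_len_mono: "finite D \<Longrightarrow> A \<subseteq> D \<Longrightarrow> line_len t A l \<le> line_len t D l"
  unfolding line_len_def by (rule card_mono) auto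

lemma sum_line_len:
  assumes "finite A" "line_of t ` A \<subseteq> {..<M}"
  shows "(\<Sum>l<M. line_len t A l) = card A"
proof -
  have "A = (\<Union>l\<in>{..<M}. {c \<in> A. line_of t c = l})" using assms(2) by auto
  then have "card A = card (\<Union>l\<in>{..<M}. {c \<in> A. line_of t c = l})" by simp
  also have "\<dots> = (\<Sum>l<M. line_len t A l)"
    unfolding line_len_def using assms(1) by (intro card_UN_disjoint) auto
  finally show ?thesis by simp
qed

text \<open>The first \<open>k\<close> strips take at most one cell each from every line, so
  together at most \<open>k\<close> cells of it and never more than its length.\<close>

lemma peelings_pos_imp_bound:
  assumes "finite D" "line_of t ` D \<subseteq> {..<M}" "0 < peelings r D (map (Pair t) ns)"
  shows "sum_list (take k ns) \<le> (\<Sum>l<M. min k (line_len t D l))"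
  using assms
proof (induction ns arbitrary: D k)
  case (Cons n ns)
  show ?case
  proof (cases k)
    case (Suc k')
    have "\<exists>A\<in>strips r D t n. 0 < peelings r (D - A) (map (Pair t) ns)"
    proof (rule ccontr)
      assume "\<not> ?thesis"
      then have "(\<Sum>A\<in>strips r D t n. peelings r (D - A) (map (Pair t) ns)) \<le> 0"
        by (intro sum_nonpos) (auto simp: not_less)
      then show False using Cons.prems(3) by simp
    qed
    then obtain A where A: "A \<in> strips r D t n" and pos: "0 < peelings r (D - A) (map (Pair t) ns)"
      by blast
    note a = stripsD[OF A]
    have finA: "finite A" using a(1) Cons.prems(1) finite_subset by blast
    have IH: "sum_list (take k' ns) \<le> (\<Sum>l<M. min k' (line_len t (D - A) l))"
      using Cons.IH[of "D - A"] Cons.prems pos by auto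
    have n: "n = (\<Sum>l<M. line_len t A l)"
      using sum_line_len[OF finA, of t M] a(2) image_mono[OF a(1), of "line_of t"] Cons.prems(2)
      by simp
    have le1: "line_len t A l \<le> 1" for l
    proof -
      have "finite {c \<in> A. line_of t c = l}" using finA by simp
      moreover have "x = y" if "x \<in> {c \<in> A. line_of t c = l}" "y \<in> {c \<in> A. line_of t c = l}" for x y
        using that inj_onD[OF a(3), of x y] by simp
      ultimately show ?thesis unfolding line_len_def One_nat_def by (simp only: card_le_Suc0_iff_eq) blast
    qed
    have "line_len t A l + min k' (line_len t (D - A) l) \<le> min k (line_len t D l)" for l
      using line_len_diff[OF Cons.prems(1) a(1), of t l] line_len_mono[OF Cons.prems(1) a(1), of t l]
        le1[of l] Suc by arith
    then have "(\<Sum>l<M. line_len t A l + min k' (line_len t (D - A) l)) \<le> (\<Sum>l<M. min k (line_len t D l))"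
      by (intro sum_mono)
    then show ?thesis using IH n by (simp add: Suc sum.distrib)
  qed simp
qed simp

text \<open>Expressing the order through \<open>t\<close> lets one proof cover rows and
  columns.\<close>

lemma cell_le_lines: "cell_le x y \<longleftrightarrow> line_of t x \<le> line_of t y \<and> line_of (\<not> t) x \<le> line_of (\<not> t) y"
  by (cases t) (auto simp: line_of_def cell_le_def)

lemma cell_eq_lines: "x = y \<longleftrightarrow> line_of t x = line_of t y \<and> line_of (\<not> t) x = line_of (\<not> t) y"
  by (cases t) (auto simp: line_of_def prod_eq_iff)

lemma cell_with_lines: "\<exists>z. line_of t z = a \<and> line_of (\<not> t) z = b"
  by (cases t) (auto simp: line_of_def)

text \<open>Greedy peeling shows that the bound is attained: each step takes the first cell of every
  nonempty line and so shortens all nonempty lines by one.\<close>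

lemma peelings_long_lines_pos:
  assumes "finite D" "cell_convex D" "\<And>l. line_len t D l \<le> K"
  shows "0 < peelings cell_le D (map (Pair t) (map (\<lambda>k. long_lines t D (Suc k)) [0..<K]))"
  using assms
proof (induction K arbitrary: D)
  case 0
  have "c \<notin> D" for c
  proof
    assume "c \<in> D"
    then have "c \<in> {x \<in> D. line_of t x = line_of t c}" by simp
    moreover have "finite {x \<in> D. line_of t x = line_of t c}" using 0(1) by simp
    ultimately have "line_len t D (line_of t c) \<noteq> 0" unfolding line_len_def using card_0_eq by blast
    then show False using 0(3) by simp
  qed
  then show ?case by auto
next
  case (Suc K)
  note D = Suc.prems(1,2)
  define A where "A = {c \<in> D. \<forall>c'\<in>D. line_of t c' = line_of t c \<longrightarrow> cell_le c c'}"
  have AD: "A \<subseteq> D" by (auto simp: A_def)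
  have Aleast: "line_of (\<not> t) c \<le> line_of (\<not> t) c'" if "c \<in> A" "c' \<in> D" "line_of t c' = line_of t c" for c c'
    using that cell_le_lines[of c c' t] by (auto simp: A_def)
  have Ainj: "x = y" if "x \<in> A" "y \<in> A" "line_of t x = line_of t y" for x y
  proof -
    have "x \<in> D" "y \<in> D" using that AD by auto
    then have "line_of (\<not> t) x = line_of (\<not> t) y"
      using Aleast[OF that(1) _ that(3)[symmetric]] Aleast[OF that(2) _ that(3)] by (intro antisym)
    then show ?thesis using cell_eq_lines that(3) by blast
  qed
  have Aex: "\<exists>a\<in>A. line_of t a = line_of t c" if "c \<in> D" for c
  proof -
    let ?C = "{x \<in> D. line_of t x = line_of t c}"
    have "finite ?C" "?C \<noteq> {}" using D that by (simp, blast)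
    then obtain a where a: "a \<in> ?C" "\<And>x. x \<in> ?C \<Longrightarrow> line_of (\<not> t) a \<le> line_of (\<not> t) x"
      using arg_min_if_finite[of ?C "line_of (\<not> t)"] by (metis (no_types, lifting) linorder_not_less)
    then have "a \<in> D" "\<forall>c'\<in>D. line_of t c' = line_of t a \<longrightarrow> cell_le a c'"
      using cell_le_lines[of a _ t] by simp_all
    then have "a \<in> A" by (simp add: A_def)
    then show ?thesis using a by blast
  qed
  have lines: "line_of t ` A = {l. 1 \<le> line_len t D l}"
  proof -
    have nonempty: "1 \<le> line_len t D l \<longleftrightarrow> (\<exists>c\<in>D. line_of t c = l)" for l
    proof -
      have "finite {c \<in> D. line_of t c = l}" using D(1) by simp
      then have "0 < line_len t D l \<longleftrightarrow> {c \<in> D. line_of t c = l} \<noteq> {}"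
        unfolding line_len_def card_gt_0_iff by blast
      then show ?thesis unfolding One_nat_def Suc_le_eq by blast
    qed
    show ?thesis unfolding nonempty
    proof (intro equalityI subsetI)
      fix l assume "l \<in> line_of t ` A"
      then show "l \<in> {l. \<exists>c\<in>D. line_of t c = l}" using AD by blast
    next
      fix l assume "l \<in> {l. \<exists>c\<in>D. line_of t c = l}"
      then obtain c where "c \<in> D" "line_of t c = l" by blast
      then obtain a where "a \<in> A" "line_of t a = l" using Aex[of c] by blast
      then show "l \<in> line_of t ` A" by blast
    qed
  qed
  have A: "A \<in> strips cell_le D t (long_lines t D 1)"
  proof (rule stripsI)
    show "A \<subseteq> D" by (rule AD)
    show "card A = long_lines t D 1"
      unfolding long_lines_def lines[symmetric] using Ainj by (metis card_image inj_onI)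
    show "x = y" if "x \<in> A" "y \<in> A" "line_of t x = line_of t y" for x y using Ainj that .
    show "y \<in> A" if xy: "x \<in> A" "y \<in> D" "cell_le y x" for x y
    proof -
      have "cell_le y c'" if c': "c' \<in> D" "line_of t c' = line_of t y" for c'
      proof (rule ccontr)
        assume "\<not> cell_le y c'"
        then have lt: "line_of (\<not> t) c' < line_of (\<not> t) y" using cell_le_lines[of y c' t] c' by auto
        \<comment> \<open>\<open>z\<close> is the cell in the line of \<open>x\<close> level with
          \<open>c'\<close>. It lies between \<open>c'\<close> and \<open>x\<close>, so convexity
          puts it into \<open>D\<close>, before the first cell \<open>x\<close> of its line.\<close>
        obtain z where z: "line_of t z = line_of t x" "line_of (\<not> t) z = line_of (\<not> t) c'"
          using cell_with_lines by metis
        have yx: "line_of t y \<le> line_of t x" "line_of (\<not> t) y \<le> line_of (\<not> t) x"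
          using xy(3) cell_le_lines by blast+
        have "z \<in> D"
        proof (rule cell_convexD[OF D(2) c'(1)])
          show "x \<in> D" using xy AD by blast
          show "cell_le c' z" "cell_le z x"
            using z yx lt c' by (auto simp: cell_le_lines[of _ _ t])
        qed
        from Aleast[OF xy(1) this z(1)] show False using z lt yx by simp
      qed
      then show ?thesis using xy by (auto simp: A_def)
    qed
  qed
  have finA: "finite A" using AD D finite_subset by blast
  have lenA: "line_len t A l = (if 1 \<le> line_len t D l then 1 else 0)" for l
  proof (cases "1 \<le> line_len t D l")
    case True
    then obtain a where "a \<in> A" "line_of t a = l" using lines by (metis (mono_tags, lifting) imageE mem_Collect_eq)
    then have "{c \<in> A. line_of t c = l} = {a}" using Ainj by blast
    then show ?thesis using True by (simp add: line_len_def)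
  next
    case False
    then show ?thesis using line_len_mono[OF D(1) AD, of t l] by simp
  qed
  have len: "line_len t (D - A) l = line_len t D l - 1" for l
    using line_len_diff[OF D(1) AD, of t l] lenA[of l] by simp
  have long: "long_lines t (D - A) (Suc k) = long_lines t D (Suc (Suc k))" for k
    unfolding long_lines_def len by (rule arg_cong[where f = card]) auto
  have "0 < peelings cell_le (D - A) (map (Pair t) (map (\<lambda>k. long_lines t (D - A) (Suc k)) [0..<K]))"
  proof (rule Suc.IH)
    show "line_len t (D - A) l \<le> K" for l using Suc.prems(3)[of l] len[of l] by simp
  qed (use D cell_convex_diff[OF D(2) A] in auto)
  then have pos: "0 < peelings cell_le (D - A) (map (Pair t) (map (\<lambda>k. long_lines t D (Suc (Suc k))) [0..<K]))"
    by (simp add: long)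
  have "map (Pair t) (map (\<lambda>k. long_lines t D (Suc k)) [0..<Suc K])
      = (t, long_lines t D 1) # map (Pair t) (map (\<lambda>k. long_lines t D (Suc (Suc k))) [0..<K])"
    by (simp only: map_upt_Suc list.map One_nat_def)
  then show ?case
    using A pos peelings_nonneg finite_strips[OF D(1)] by (auto intro!: sum_pos2)
qed

text \<open>The greedy word of either shape can be peeled from the other as well, so the bounds
  compare the partial sums in both directions; differences of consecutive partial sums give the
  claim.\<close>

lemma long_lines_eq_if_peelings_eq:
  assumes D: "finite D" "cell_convex D" and E: "finite E" "cell_convex E"
    and eq: "\<And>w. peelings cell_le D w = peelings cell_le E w"
  shows "long_lines t D (Suc k) = long_lines t E (Suc k)"
proof -
  have "finite (line_of t ` (D \<union> E))" using D E by simp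
  then obtain M where "\<forall>n\<in>line_of t ` (D \<union> E). n < M" unfolding finite_nat_set_iff_bounded by blast
  then have M: "line_of t ` D \<subseteq> {..<M}" "line_of t ` E \<subseteq> {..<M}" by auto
  have levels: "(\<Sum>l<M. min k (line_len t F l)) = (\<Sum>i<k. long_lines t F (Suc i))"
    if "line_of t ` F \<subseteq> {..<M}" for F k
  proof -
    have "line_len t F l = 0" if "M \<le> l" for l
    proof -
      have "{c \<in> F. line_of t c = l} = {}" using \<open>line_of t ` F \<subseteq> {..<M}\<close> that by fastforce
      then show ?thesis unfolding line_len_def by (metis card.empty)
    qed
    then show ?thesis unfolding long_lines_def by (rule sum_min_eq_sum_levels)
  qed
  have le: "(\<Sum>i<k. long_lines t F (Suc i)) \<le> (\<Sum>i<k. long_lines t G (Suc i))"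
    if F: "finite F" "cell_convex F" and G: "finite G" "line_of t ` G \<subseteq> {..<M}"
      and FG: "\<And>w. peelings cell_le F w = peelings cell_le G w" for F G k
  proof -
    \<comment> \<open>Large enough to bound every line length and to make \<open>take k\<close>
      return all \<open>k\<close> terms.\<close>
    let ?K = "k + card F"
    let ?ns = "map (\<lambda>k. long_lines t F (Suc k)) [0..<?K]"
    have "line_len t F l \<le> ?K" for l
      unfolding line_len_def by (rule trans_le_add2, rule card_mono) (use F in auto)
    from peelings_long_lines_pos[OF F this]
    have "sum_list (take k ?ns) \<le> (\<Sum>l<M. min k (line_len t G l))"
      by (intro peelings_pos_imp_bound[OF G]) (simp add: FG)
    also have "\<dots> = (\<Sum>i<k. long_lines t G (Suc i))" by (rule levels[OF G(2)])
    finally show ?thesis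
      by (simp add: take_map take_upt interv_sum_list_conv_sum_set_nat atLeast0LessThan)
  qed
  have "(\<Sum>i<k. long_lines t D (Suc i)) = (\<Sum>i<k. long_lines t E (Suc i))" for k
    using le[OF D E(1) M(2) eq, of k] le[OF E D(1) M(1) eq[symmetric], of k] by simp
  from this[of k] this[of "Suc k"] show ?thesis by simp
qed

section \<open>Overlaps of rows\<close>

lemma line_len_row: "line_len False D i = card (row D i)"
proof -
  have "{c \<in> D. line_of False c = i} = Pair i ` row D i"
    by (auto simp: line_of_def row_def)
  then show ?thesis unfolding line_len_def by (simp add: card_image inj_on_def)
qed

lemma line_len_column:
  assumes "D \<subseteq> {..<M} \<times> {..<M}"
  shows "line_len True D j = (\<Sum>i<M. if (i, j) \<in> D then 1 else 0)"
proof -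
  have "{c \<in> D. line_of True c = j} = (\<lambda>i. (i, j)) ` {i \<in> {..<M}. (i, j) \<in> D}"
    using assms by (auto simp: line_of_def)
  then have "line_len True D j = card {i \<in> {..<M}. (i, j) \<in> D}"
    unfolding line_len_def by (simp add: card_image inj_on_def)
  then show ?thesis by (simp add: sum.If_cases Int_def)
qed

text \<open>Both sides count ordered pairs of cells in a common column.\<close>

lemma sum_column_squares:
  assumes D: "D \<subseteq> {..<M} \<times> {..<M}"
  shows "(\<Sum>j<M. (int (line_len True D j))\<^sup>2) = (\<Sum>i<M. \<Sum>i'<M. int (card (row D i \<inter> row D i')))"
proof -
  define x :: "nat \<Rightarrow> nat \<Rightarrow> int" where "x i j = (if (i, j) \<in> D then 1 else 0)" for i j
  have meet: "int (card (row D i \<inter> row D i')) = (\<Sum>j<M. x i j * x i' j)" for i i'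
  proof -
    have "row D i \<inter> row D i' = {j \<in> {..<M}. (i, j) \<in> D \<and> (i', j) \<in> D}"
      using D by (auto simp: row_def)
    moreover have "x i j * x i' j = (if (i, j) \<in> D \<and> (i', j) \<in> D then 1 else 0)" for j
      by (simp add: x_def)
    ultimately show ?thesis by (simp add: sum.If_cases Int_def)
  qed
  have "int (line_len True D j) = (\<Sum>i<M. x i j)" for j
    by (auto simp: line_len_column[OF D] x_def intro!: sum.cong)
  then have "(\<Sum>j<M. (int (line_len True D j))\<^sup>2) = (\<Sum>j<M. \<Sum>i<M. \<Sum>i'<M. x i j * x i' j)"
    by (simp add: power2_eq_square sum_product)
  also have "\<dots> = (\<Sum>i<M. \<Sum>j<M. \<Sum>i'<M. x i j * x i' j)"
    by (rule sum.swap)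
  also have "\<dots> = (\<Sum>i<M. \<Sum>i'<M. \<Sum>j<M. x i j * x i' j)"
    by (intro sum.cong refl sum.swap)
  finally show ?thesis by (simp add: meet)
qed

lemma line_len_outside:
  assumes "D \<subseteq> {..<M} \<times> {..<M}" "M \<le> l"
  shows "line_len t D l = 0"
proof -
  have "{c \<in> D. line_of t c = l} = {}" using assms by (auto simp: line_of_def)
  then show ?thesis unfolding line_len_def by (metis card.empty)
qed

text \<open>The squares of the column lengths sum up to the sizes of all pairwise intersections of
  rows, so the row and column lengths alone decide whether the rows form a chain.\<close>
lemma rows_nested_if_long_lines_eq:
  assumes D: "finite D" and E: "finite E"
    and eq: "\<And>t k. long_lines t D (Suc k) = long_lines t E (Suc k)"
    and nested: "\<And>i i'. card (row E i \<inter> row E i') = min (card (row E i)) (card (row E i'))"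
  shows "card (row D i \<inter> row D i') = min (card (row D i)) (card (row D i'))"
proof -
  have "finite (fst ` (D \<union> E) \<union> snd ` (D \<union> E))" using D E by simp
  then obtain M where "\<forall>n\<in>fst ` (D \<union> E) \<union> snd ` (D \<union> E). n < M"
    unfolding finite_nat_set_iff_bounded by blast
  then have "fst c < M \<and> snd c < M" if "c \<in> D \<union> E" for c using that by blast
  then have M: "D \<subseteq> {..<M} \<times> {..<M}" "E \<subseteq> {..<M} \<times> {..<M}"
    by (simp_all add: subset_iff mem_Times_iff del: split_paired_All)
  let ?K = "card D + card E"
  have "line_len t D l \<le> card D" "line_len t E l \<le> card E" for t l
    unfolding line_len_def using D E by (auto intro: card_mono)
  then have K: "line_len t D l \<le> ?K" "line_len t E l \<le> ?K" for t l
    by (meson trans_le_add1 trans_le_add2)+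
  have same: "(\<Sum>l<M. F (line_len t D l)) = (\<Sum>l<M. F (line_len t E l))" for F :: "nat \<Rightarrow> int" and t
    using sum_over_levels[of "line_len t D" ?K M F, OF K(1) line_len_outside[OF M(1)]]
      sum_over_levels[of "line_len t E" ?K M F, OF K(2) line_len_outside[OF M(2)]]
      eq[of t] unfolding long_lines_def by simp
  let ?R = "\<lambda>F i. line_len False F i"
  \<comment> \<open>\<open>H n\<close> is the sum of \<open>min n\<close> with all row lengths. It
    is the same function for both shapes, so the double sum of minima becomes a sum of
    \<open>H\<close> over row lengths, to which \<open>same\<close> applies.\<close>
  define H where "H n = (\<Sum>k<n. long_lines False E (Suc k))" for n
  have HE: "(\<Sum>l<M. min n (?R E l)) = H n" for n
    unfolding H_def long_lines_def by (rule sum_min_eq_sum_levels) (rule line_len_outside[OF M(2)])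
  have HD: "(\<Sum>l<M. min n (?R D l)) = H n" for n
    unfolding H_def eq[symmetric] unfolding long_lines_def
    by (rule sum_min_eq_sum_levels) (rule line_len_outside[OF M(1)])
  have "(\<Sum>i<M. \<Sum>i'<M. int (card (row D i \<inter> row D i'))) = (\<Sum>i<M. \<Sum>i'<M. int (card (row E i \<inter> row E i')))"
    unfolding sum_column_squares[OF M(1), symmetric] sum_column_squares[OF M(2), symmetric]
    by (rule same)
  also have "\<dots> = (\<Sum>i<M. int (\<Sum>i'<M. min (?R E i) (?R E i')))"
    by (simp add: nested line_len_row)
  also have "\<dots> = (\<Sum>i<M. int (\<Sum>i'<M. min (?R D i) (?R D i')))"
    unfolding HD HE by (rule same[symmetric])
  finally have total: "(\<Sum>i<M. \<Sum>i'<M. card (row D i \<inter> row D i')) = (\<Sum>i<M. \<Sum>i'<M. min (?R D i) (?R D i'))"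
    unfolding of_nat_sum[symmetric] of_nat_eq_iff .
  have le: "card (row D i \<inter> row D i') \<le> min (?R D i) (?R D i')" for i i'
    unfolding line_len_row using finite_row[OF D] by (auto intro: card_mono)
  show ?thesis
  proof (cases "i < M \<and> i' < M")
    case True
    \<comment> \<open>The totals agree while each term is bounded by \<open>le\<close>, so equality
      holds first for every \<open>i\<close> and then for every \<open>i'\<close>.\<close>
    have "(\<Sum>i'<M. card (row D i \<inter> row D i')) = (\<Sum>i'<M. min (?R D i) (?R D i'))"
      by (rule sum_mono_inv[OF total]) (use True le in \<open>auto intro: sum_mono\<close>)
    then have "card (row D i \<inter> row D i') = min (?R D i) (?R D i')"
      by (rule sum_mono_inv) (use True le in auto)
    then show ?thesis by (simp add: line_len_row)
  next
    case False
    then have "row D i = {} \<or> row D i' = {}" using M(1) by (auto simp: row_def)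
    then show ?thesis by auto
  qed
qed

section \<open>Diagrams, segments and translations\<close>

lemma part_antimono: "is_partition la \<Longrightarrow> i \<le> k \<Longrightarrow> part la k \<le> part la i"
  unfolding is_partition_def part_def
  by (cases "i = k") (auto intro: sorted_wrt_nth_less[of "(\<ge>)"])

lemma mem_diagram: "(i, j) \<in> diagram la \<longleftrightarrow> j < part la i"
  by (auto simp: diagram_def part_def)

lemma mem_skew_diagram: "(i, j) \<in> skew_diagram la mu \<longleftrightarrow> part mu i \<le> j \<and> j < part la i"
  by (auto simp: skew_diagram_def mem_diagram)

lemma diagram_eq_skew_diagram: "diagram la = skew_diagram la []"
  by (auto simp: skew_diagram_def diagram_def)

lemma finite_skew_diagram: "finite (skew_diagram la mu)"
proof -
  have "diagram la = Sigma {..<length la} (\<lambda>i. {..<la ! i})" by (auto simp: diagram_def)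
  then show ?thesis by (simp add: skew_diagram_def)
qed

lemma cell_convex_skew_diagram:
  assumes "is_partition la" "is_partition mu"
  shows "cell_convex (skew_diagram la mu)"
  unfolding cell_convex_def
proof (intro ballI allI impI)
  fix x z y :: "nat \<times> nat"
  assume *: "x \<in> skew_diagram la mu" "z \<in> skew_diagram la mu" "cell_le x y" "cell_le y z"
  obtain i j a b i' j' where "x = (i, j)" "y = (a, b)" "z = (i', j')" by (cases x, cases y, cases z)
  then show "y \<in> skew_diagram la mu"
    using * part_antimono[OF assms(1), of a i'] part_antimono[OF assms(2), of i a]
    by (simp add: mem_skew_diagram)
qed

text \<open>An interval is recovered from one end and its size. This and its mirror image
  \<open>final_segment_iff\<close> read a shape off its level counts; the explicit comparison with
  the end guards against truncated subtraction.\<close>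

lemma initial_segment_iff:
  fixes S :: "nat set"
  assumes "finite S" "\<And>l. l \<in> S \<Longrightarrow> p \<le> l" "\<And>l l'. l \<in> S \<Longrightarrow> p \<le> l' \<Longrightarrow> l' \<le> l \<Longrightarrow> l' \<in> S"
  shows "l \<in> S \<longleftrightarrow> p \<le> l \<and> l - p < card S"
proof (cases "S = {}")
  case False
  then have M: "Max S \<in> S" using assms(1) by simp
  have "S = {p..Max S}"
  proof (intro equalityI subsetI)
    show "x \<in> {p..Max S}" if "x \<in> S" for x using assms(1) assms(2)[OF that] that by simp
    show "x \<in> S" if "x \<in> {p..Max S}" for x using assms(3)[OF M, of x] that by simp
  qed
  then have "card S = Suc (Max S) - p" by (metis card_atLeastAtMost)
  moreover have "l \<in> S \<longleftrightarrow> p \<le> l \<and> l \<le> Max S" using \<open>S = {p..Max S}\<close> by (metis atLeastAtMost_iff)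
  ultimately show ?thesis using assms(2)[OF M] by auto
qed simp

lemma final_segment_iff:
  fixes S :: "nat set"
  assumes "\<And>l. l \<in> S \<Longrightarrow> l \<le> q" "\<And>l l'. l \<in> S \<Longrightarrow> l \<le> l' \<Longrightarrow> l' \<le> q \<Longrightarrow> l' \<in> S"
  shows "l \<in> S \<longleftrightarrow> l \<le> q \<and> q - l < card S"
proof (cases "S = {}")
  case False
  have "finite S" using assms(1) unfolding finite_nat_set_iff_bounded_le by blast
  then have M: "Min S \<in> S" using False by simp
  have "S = {Min S..q}"
  proof (intro equalityI subsetI)
    show "x \<in> {Min S..q}" if "x \<in> S" for x using \<open>finite S\<close> assms(1)[OF that] that by simp
    show "x \<in> S" if "x \<in> {Min S..q}" for x using assms(2)[OF M, of x] that by simp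
  qed
  then have "card S = Suc q - Min S" by (metis card_atLeastAtMost)
  moreover have "l \<in> S \<longleftrightarrow> Min S \<le> l \<and> l \<le> q" using \<open>S = {Min S..q}\<close> by (metis atLeastAtMost_iff)
  ultimately show ?thesis using assms(1)[OF M] by auto
qed simp

lemma same_up_to_translationI:
  assumes "\<And>i j. (i, j) \<in> D \<longleftrightarrow> p \<le> i \<and> m \<le> j \<and> (i - p, j - m) \<in> E"
  shows "same_up_to_translation (to_int D) (to_int E)"
  unfolding same_up_to_translation_def
proof (intro exI equalityI subsetI)
  fix y assume "y \<in> (\<lambda>(i, j). (i + - int p, j + - int m)) ` to_int D"
  then obtain i j where ij: "(i, j) \<in> D" "y = (int i - int p, int j - int m)"
    by (auto simp: to_int_def)
  then have "(i - p, j - m) \<in> E" "y = (int (i - p), int (j - m))"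
    using assms by (auto simp: of_nat_diff)
  then show "y \<in> to_int E" unfolding to_int_def by force
next
  fix y assume "y \<in> to_int E"
  then obtain i j where ij: "(i, j) \<in> E" "y = (int i, int j)" by (auto simp: to_int_def)
  then have "(i + p, j + m) \<in> D" using assms by simp
  then have "(int (i + p), int (j + m)) \<in> to_int D" unfolding to_int_def by force
  then show "y \<in> (\<lambda>(i, j). (i + - int p, j + - int m)) ` to_int D" using ij by force
qed

text \<open>The second premise keeps \<open>E\<close> inside the rectangle in which
  \<open>q - i\<close> and \<open>m - j\<close> are not truncated, so that every cell of
  \<open>E\<close> is reached.\<close>

lemma same_up_to_translation_rot180I:
  assumes "\<And>i j. (i, j) \<in> D \<longleftrightarrow> i \<le> q \<and> j \<le> m \<and> (q - i, m - j) \<in> E"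
    and "\<And>i j. (i, j) \<in> E \<Longrightarrow> i \<le> q \<and> j \<le> m"
  shows "same_up_to_translation (to_int D) (rot180 (to_int E))"
  unfolding same_up_to_translation_def
proof (intro exI equalityI subsetI)
  fix y assume "y \<in> (\<lambda>(i, j). (i + - int q, j + - int m)) ` to_int D"
  then obtain i j where ij: "(i, j) \<in> D" "y = (int i - int q, int j - int m)"
    by (auto simp: to_int_def)
  then have "(q - i, m - j) \<in> E" "y = (- int (q - i), - int (m - j))"
    using assms(1) by (auto simp: of_nat_diff)
  then show "y \<in> rot180 (to_int E)" unfolding to_int_def rot180_def by force
next
  fix y assume "y \<in> rot180 (to_int E)"
  then obtain i j where ij: "(i, j) \<in> E" "y = (- int i, - int j)"
    by (auto simp: to_int_def rot180_def)
  then have le: "i \<le> q" "j \<le> m" and "(q - i, m - j) \<in> D" using assms by auto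
  then have "(int (q - i), int (m - j)) \<in> to_int D" unfolding to_int_def by force
  then show "y \<in> (\<lambda>(i, j). (i + - int q, j + - int m)) ` to_int D"
    using ij le by (force simp: of_nat_diff)
qed

subsection \<open>The shape\<close>

text \<open>Once all nonempty rows share an end, the rows longer than \<open>k\<close> form a
  segment starting at the first or ending at the last nonempty row. Its size is the length of column
  \<open>k\<close> of \<open>E\<close>, which fixes every cell of \<open>D\<close>.\<close>

lemma skew_diagram_shape_if_rows_nested:
  fixes la mu nu :: "nat list"
  assumes la: "is_partition la" and mu: "is_partition mu" and nu: "is_partition nu"
  defines "D \<equiv> skew_diagram la mu" and "E \<equiv> diagram nu"
  assumes long: "\<And>k. long_lines False D (Suc k) = long_lines False E (Suc k)"
    and nested: "\<And>i i'. card (row D i \<inter> row D i') = min (card (row D i)) (card (row D i'))"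
  shows "same_up_to_translation (to_int D) (to_int E) \<or>
    same_up_to_translation (to_int D) (rot180 (to_int E))"
proof -
  have rowD: "row D i = {part mu i..<part la i}" for i
    by (auto simp: row_def D_def mem_skew_diagram)
  have rowE: "row E i = {..<part nu i}" for i
    by (auto simp: row_def E_def mem_diagram)
  \<comment> \<open>By \<open>E_iff\<close> below, \<open>a j\<close> is the length of column
    \<open>j\<close> of \<open>E\<close>.\<close>
  define a where "a k = long_lines False E (Suc k)" for k
  have finlong: "finite {l. Suc k \<le> part x l}" for k x
    by (rule finite_subset[of _ "{..<length x}"]) (auto simp: part_def split: if_splits)
  have E_iff: "(i, j) \<in> E \<longleftrightarrow> i < a j" for i j
  proof -
    have "i \<in> {l. Suc j \<le> part nu l} \<longleftrightarrow> 0 \<le> i \<and> i - 0 < card {l. Suc j \<le> part nu l}"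
      by (rule initial_segment_iff[OF finlong])
        (use part_antimono[OF nu] in \<open>auto intro: le_trans\<close>)
    then show ?thesis unfolding a_def long_lines_def line_len_row rowE
      by (simp add: E_def mem_diagram Suc_le_eq)
  qed
  have a_D: "a k = card {l. Suc k \<le> part la l - part mu l}" for k
    using long[of k] by (simp add: a_def long_lines_def line_len_row rowD)
  define I where "I = {i. part mu i < part la i}"
  have inI: "l \<in> I" if "Suc k \<le> part la l - part mu l" for k l using that by (simp add: I_def)
  have DI: "i \<in> I" if "(i, j) \<in> D" for i j using that by (simp add: D_def mem_skew_diagram I_def)
  have finI: "finite I"
    by (rule finite_subset[OF _ finlong[of 0 la]]) (auto simp: I_def)
  show ?thesis
  proof (cases "I = {}")
    case True
    then have "{l. Suc k \<le> part la l - part mu l} = {}" for k using inI by blast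
    then have "a k = 0" for k using a_D by (metis card.empty)
    moreover have "(i, j) \<notin> D" for i j using True DI by blast
    ultimately have "same_up_to_translation (to_int D) (to_int E)"
      by (intro same_up_to_translationI[of _ 0 0]) (simp add: E_iff)
    then show ?thesis ..
  next
    case False
    define p where "p = Min I"
    define q where "q = Max I"
    have pI: "p \<in> I" and qI: "q \<in> I" and pq: "\<And>i. i \<in> I \<Longrightarrow> p \<le> i \<and> i \<le> q"
      using finI False by (auto simp: p_def q_def)
    have mono: "part la k \<le> part la i" "part mu k \<le> part mu i" if "i \<le> k" for i k
      using part_antimono[OF la that] part_antimono[OF mu that] by auto
    have "row D p \<inter> row D q = {part mu p..<part la q}"
      using mono[of p q] pq[OF pI] by (auto simp: rowD)
    then have "part la q - part mu p = min (part la p - part mu p) (part la q - part mu q)"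
      using nested[of p q] by (simp add: rowD)
    \<comment> \<open>Both rows are nonempty, so the minimum is positive and no subtraction is
      truncated; each value of the minimum equates one pair of ends.\<close>
    then consider "part mu p = part mu q" | "part la p = part la q"
      using pI qI mono[of p q] pq[OF pI] unfolding I_def by fastforce
    then show ?thesis
    proof cases
      case 1
      define m where "m = part mu p"
      have mu_const: "part mu i = m" if "p \<le> i" "i \<le> q" for i
        using mono(2)[OF that(1)] mono(2)[OF that(2)] 1 by (simp add: m_def)
      have seg: "l \<in> {l. Suc k \<le> part la l - part mu l} \<longleftrightarrow> p \<le> l \<and> l - p < a k" for k l
        unfolding a_D
      proof (rule initial_segment_iff)
        show "finite {l. Suc k \<le> part la l - part mu l}"
          by (rule finite_subset[OF _ finI]) (use inI in blast)
        show "p \<le> l" if "l \<in> {l. Suc k \<le> part la l - part mu l}" for l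
          using inI pq that by blast
        show "l' \<in> {l. Suc k \<le> part la l - part mu l}"
          if "l \<in> {l. Suc k \<le> part la l - part mu l}" "p \<le> l'" "l' \<le> l" for l l'
        proof -
          have "l \<le> q" using inI pq that(1) by blast
          then have "part mu l' = m" "part mu l = m" using mu_const that by auto
          then show ?thesis using that(1) mono(1)[OF that(3)] by simp
        qed
      qed
      have "(i, j) \<in> D \<longleftrightarrow> p \<le> i \<and> m \<le> j \<and> (i - p, j - m) \<in> E" for i j
      proof
        assume ij: "(i, j) \<in> D"
        then have "i \<in> I" by (rule DI)
        then have "part mu i = m" using pq mu_const by blast
        then have "m \<le> j" "Suc (j - m) \<le> part la i - part mu i"
          using ij by (auto simp: D_def mem_skew_diagram)
        then show "p \<le> i \<and> m \<le> j \<and> (i - p, j - m) \<in> E" using seg[of i "j - m"] by (simp add: E_iff)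
      next
        assume r: "p \<le> i \<and> m \<le> j \<and> (i - p, j - m) \<in> E"
        then have s: "Suc (j - m) \<le> part la i - part mu i" using seg[of i "j - m"] by (simp add: E_iff)
        then have "part mu i = m" using inI pq mu_const by blast
        then show "(i, j) \<in> D" using r s by (auto simp: D_def mem_skew_diagram)
      qed
      then show ?thesis using same_up_to_translationI by blast
    next
      case 2
      \<comment> \<open>Columns count from 0, so this is the last column of the common right
        end.\<close>
      define m where "m = part la p - 1"
      have m: "part la p = Suc m" using pI by (auto simp: I_def m_def)
      have la_const: "part la i = Suc m" if "p \<le> i" "i \<le> q" for i
        using mono(1)[OF that(1)] mono(1)[OF that(2)] 2 m by simp
      have seg: "l \<in> {l. Suc k \<le> part la l - part mu l} \<longleftrightarrow> l \<le> q \<and> q - l < a k" for k l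
        unfolding a_D
      proof (rule final_segment_iff)
        show "l \<le> q" if "l \<in> {l. Suc k \<le> part la l - part mu l}" for l
          using inI pq that by blast
        show "l' \<in> {l. Suc k \<le> part la l - part mu l}"
          if "l \<in> {l. Suc k \<le> part la l - part mu l}" "l \<le> l'" "l' \<le> q" for l l'
        proof -
          have "p \<le> l" using inI pq that(1) by blast
          then have "part la l' = Suc m" "part la l = Suc m" using la_const that by auto
          then show ?thesis using that(1) mono(2)[OF that(2)] by simp
        qed
      qed
      have D_iff: "(i, j) \<in> D \<longleftrightarrow> i \<le> q \<and> j \<le> m \<and> (q - i, m - j) \<in> E" for i j
      proof
        assume ij: "(i, j) \<in> D"
        then have "i \<in> I" by (rule DI)
        then have "part la i = Suc m" using pq la_const by blast
        then have "j \<le> m" "Suc (m - j) \<le> part la i - part mu i"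
          using ij by (auto simp: D_def mem_skew_diagram)
        then show "i \<le> q \<and> j \<le> m \<and> (q - i, m - j) \<in> E" using seg[of i "m - j"] by (simp add: E_iff)
      next
        assume r: "i \<le> q \<and> j \<le> m \<and> (q - i, m - j) \<in> E"
        then have s: "Suc (m - j) \<le> part la i - part mu i" using seg[of i "m - j"] by (simp add: E_iff)
        then have "part la i = Suc m" using inI pq la_const by blast
        then show "(i, j) \<in> D" using r s by (auto simp: D_def mem_skew_diagram)
      qed
      \<comment> \<open>Column \<open>j\<close> of \<open>E\<close> has as many cells as
        \<open>D\<close> has rows longer than \<open>j\<close>. These rows lie between
        \<open>p\<close> and \<open>q\<close>, and none is longer than \<open>Suc m\<close>.\<close>
      have E_bound: "i \<le> q \<and> j \<le> m" if "(i, j) \<in> E" for i j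
      proof -
        let ?S = "{l. Suc j \<le> part la l - part mu l}"
        have "?S \<subseteq> {p..q}" using inI pq by auto
        then have "card ?S \<le> Suc q - p" using card_mono[of "{p..q}" ?S] by simp
        moreover have "i < card ?S" using that by (simp add: E_iff a_D)
        moreover obtain l where "l \<in> ?S"
          using \<open>i < card ?S\<close> by (metis card.empty ex_in_conv not_less_zero)
        then have "part la l = Suc m" "Suc j \<le> part la l - part mu l"
          using inI pq la_const by blast+
        ultimately show ?thesis by auto
      qed
      show ?thesis using same_up_to_translation_rot180I[OF D_iff E_bound] by blast
    qed
  qed
qed

section \<open>Translated and rotated shapes\<close>

lemma peelings_eq_if_translate:
  assumes "same_up_to_translation (to_int D) (to_int E)"
  shows "peelings cell_le D w = peelings cell_le E w"
proof -
  obtain a b where ab: "(\<lambda>(i, j). (i + a, j + b)) ` to_int D = to_int E"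
    using assms by (auto simp: same_up_to_translation_def)
  define f where "f = (\<lambda>(i, j). (nat (int i + a), nat (int j + b)))"
  have pos: "0 \<le> int i + a" "0 \<le> int j + b" "f (i, j) \<in> E" if "(i, j) \<in> D" for i j
  proof -
    have "(int i + a, int j + b) \<in> to_int E" unfolding ab[symmetric] using that by (force simp: to_int_def)
    then obtain k l where "(k, l) \<in> E" "int i + a = int k" "int j + b = int l"
      by (auto simp: to_int_def)
    then show "0 \<le> int i + a" "0 \<le> int j + b" "f (i, j) \<in> E" by (auto simp: f_def)
  qed
  have "f ` D = E"
  proof
    show "f ` D \<subseteq> E" using pos(3) by auto
    show "E \<subseteq> f ` D"
    proof
      fix y assume "y \<in> E"
      moreover obtain k l where y: "y = (k, l)" by (cases y)
      ultimately have "(int k, int l) \<in> (\<lambda>(i, j). (i + a, j + b)) ` to_int D"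
        unfolding ab by (force simp: to_int_def)
      then obtain i j where "(i, j) \<in> D" "int k = int i + a" "int l = int j + b"
        by (auto simp: to_int_def)
      then show "y \<in> f ` D" by (intro image_eqI[of _ _ "(i, j)"]) (auto simp: f_def y)
    qed
  qed
  moreover have "peelings cell_le (f ` D) w = peelings cell_le D w"
  proof (rule peelings_image)
    show "inj_on f D"
    proof (rule inj_onI)
      fix x y assume "x \<in> D" "y \<in> D" "f x = f y"
      moreover obtain i j i' j' where "x = (i, j)" "y = (i', j')" by (cases x, cases y)
      ultimately show "x = y" using pos(1,2)[of i j] pos(1,2)[of i' j']
        by (simp add: f_def) linarith
    qed
    fix x y assume "x \<in> D" "y \<in> D"
    moreover obtain i j i' j' where "x = (i, j)" "y = (i', j')" by (cases x, cases y)
    ultimately show "cell_le (f x) (f y) = cell_le x y"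
      "\<And>t. (line_of t (f x) = line_of t (f y)) = (line_of t x = line_of t y)"
      using pos(1,2)[of i j] pos(1,2)[of i' j'] by (auto simp: f_def line_of_def)
  qed
  ultimately show ?thesis by simp
qed

text \<open>A rotation reverses \<open>cell_le\<close>, so it turns initial strips into final ones,
  and \<open>peelings_converse\<close> reads the word backwards.\<close>

lemma peelings_eq_if_rotate:
  assumes E: "finite E" and "same_up_to_translation (to_int D) (rot180 (to_int E))"
  shows "peelings cell_le D w = peelings cell_le E (rev w)"
proof -
  obtain a b where ab: "(\<lambda>(i, j). (i + a, j + b)) ` to_int D = rot180 (to_int E)"
    using assms by (auto simp: same_up_to_translation_def)
  define f where "f = (\<lambda>(i, j). (nat (- (int i + a)), nat (- (int j + b))))"
  have pos: "int i + a \<le> 0" "int j + b \<le> 0" "f (i, j) \<in> E" if "(i, j) \<in> D" for i j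
  proof -
    have "(int i + a, int j + b) \<in> rot180 (to_int E)"
      unfolding ab[symmetric] using that by (force simp: to_int_def)
    then obtain k l where kl: "(k, l) \<in> E" "int i + a = - int k" "int j + b = - int l"
      by (auto simp: to_int_def rot180_def)
    then show "int i + a \<le> 0" "int j + b \<le> 0" by auto
    show "f (i, j) \<in> E" unfolding f_def prod.case kl(2,3) using kl(1) by simp
  qed
  have "f ` D = E"
  proof
    show "f ` D \<subseteq> E" using pos(3) by auto
    show "E \<subseteq> f ` D"
    proof
      fix y assume "y \<in> E"
      moreover obtain k l where y: "y = (k, l)" by (cases y)
      ultimately have "(- int k, - int l) \<in> (\<lambda>(i, j). (i + a, j + b)) ` to_int D"
        unfolding ab by (force simp: to_int_def rot180_def)
      then obtain i j where "(i, j) \<in> D" "- int k = int i + a" "- int l = int j + b"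
        by (auto simp: to_int_def)
      then show "y \<in> f ` D" by (intro image_eqI[of _ _ "(i, j)"]) (auto simp: f_def y)
    qed
  qed
  moreover have "peelings (\<lambda>x y. cell_le y x) (f ` D) w = peelings cell_le D w"
  proof (rule peelings_image)
    show "inj_on f D"
    proof (rule inj_onI)
      fix x y assume "x \<in> D" "y \<in> D" "f x = f y"
      moreover obtain i j i' j' where "x = (i, j)" "y = (i', j')" by (cases x, cases y)
      ultimately show "x = y" using pos(1,2)[of i j] pos(1,2)[of i' j']
        by (simp add: f_def) linarith
    qed
    fix x y assume "x \<in> D" "y \<in> D"
    moreover obtain i j i' j' where "x = (i, j)" "y = (i', j')" by (cases x, cases y)
    ultimately show "cell_le (f y) (f x) = cell_le x y"
      "\<And>t. (line_of t (f x) = line_of t (f y)) = (line_of t x = line_of t y)"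
      using pos(1,2)[of i j] pos(1,2)[of i' j'] by (auto simp: f_def line_of_def)
  qed
  ultimately show ?thesis using peelings_converse[OF E, of cell_le w] by simp
qed

theorem theorem2p1:
  fixes la mu nu :: "nat list"
  assumes "is_partition la" and "is_partition mu" and "is_partition nu"
    and "\<forall>i. part mu i \<le> part la i"
    and "skew_connected la mu"
  shows "schur_eq (skew_diagram la mu) (diagram nu) \<longleftrightarrow>
    (same_up_to_translation (to_int (skew_diagram la mu)) (to_int (diagram nu)) \<or>
     same_up_to_translation (to_int (skew_diagram la mu)) (rot180 (to_int (diagram nu))))"
proof -
  let ?D = "skew_diagram la mu" and ?E = "diagram nu"
  let ?tra = "same_up_to_translation (to_int ?D) (to_int ?E)"
    and ?rot = "same_up_to_translation (to_int ?D) (rot180 (to_int ?E))"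
  have D: "finite ?D" "cell_convex ?D"
    using assms by (auto intro: finite_skew_diagram cell_convex_skew_diagram)
  have "is_partition []" by (simp add: is_partition_def)
  then have E: "finite ?E" "cell_convex ?E"
    unfolding diagram_eq_skew_diagram using assms(3)
    by (auto intro: finite_skew_diagram cell_convex_skew_diagram)
  note eq_iff = schur_eq_iff_peelings[OF D E]
  show ?thesis
  proof
    assume "schur_eq ?D ?E"
    then have "peelings cell_le ?D (map (Pair True) ns) = peelings cell_le ?E (map (Pair True) ns)" for ns
      unfolding eq_iff by blast
    \<comment> \<open>Words of horizontal strips control the column lengths only. The row lengths
      require vertical strips, hence the passage to arbitrary words.\<close>
    note peelings_determined_by_horizontal[OF D E this]
    then have long: "long_lines t ?D (Suc k) = long_lines t ?E (Suc k)" for t k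
      by (rule long_lines_eq_if_peelings_eq[OF D E])
    have "row ?E i = {..<part nu i}" for i by (auto simp: row_def mem_diagram)
    moreover have "{..<x} \<inter> {..<y} = {..<min x y}" for x y :: nat by auto
    ultimately have "card (row ?E i \<inter> row ?E i') = min (card (row ?E i)) (card (row ?E i'))" for i i'
      by simp
    note rows_nested_if_long_lines_eq[OF D(1) E(1) long this]
    then show "?tra \<or> ?rot"
      by (rule skew_diagram_shape_if_rows_nested[OF assms(1-3) long])
  next
    assume "?tra \<or> ?rot"
    then show "schur_eq ?D ?E"
    proof
      assume ?tra
      then show ?thesis unfolding eq_iff using peelings_eq_if_translate by blast
    next
      assume ?rot
      \<comment> \<open>The rotation reverses the word, and the symmetry of the Schur function of
        \<open>diagram nu\<close> reverses it back.\<close>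
      then show ?thesis unfolding eq_iff
        by (simp add: peelings_eq_if_rotate[OF E(1)] peelings_rev[OF E])
    qed
  qed
qed

end
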